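(* Let $n\ge2$, $p>1$, $\frac1p+\frac1{p'}=1$, $m=\frac{p-n}{p-1}$, $-m<l\le 1-m$, and let $\Omega=\{x\in\mathbb{R}^n:|x|<\varphi(x)\}$ be a bounded domain, star-shaped with respect to a small ball centered at the origin, where $\varphi$ is homogeneous of degree $0$. Then for every $u\in W^{1,p}_0(|x|^{l(1-p)},\Omega)$, $u\not\equiv0$, $$\left(\int_\Omega|x|^{l(1-p)}\left|\frac{\langle x,\nabla u\rangle}{|x|}\right|^pdx\right)^{\frac1p}\ge\frac{m+l}{p'}\left(\int_\Omega\frac{|u|^p}{|x|^{n-m-l}\left|\varphi^{m+l}(x)-|x|^{m+l}\right|^p}dx\right)^{\frac1p}$$ $$+\frac1p\limsup_{\varepsilon\to0}\varepsilon^{1-n}\int_{S_\varepsilon}\frac{|u(x)|^p\,dS}{\varphi^{(m+l)(p-1)}(x)}\left(\int_\Omega\frac{|u|^p}{|x|^{n-m-l}\left|\varphi^{m+l}(x)-|x|^{m+l}\right|^p}dx\right)^{-\frac1{p'}},$$ where $S_\varepsilon=\{|x|=\varepsilon\}$.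
   Context: A bounded domain with $C^0$ boundary is star-shaped with respect to a point $x_0\in\Omega$ if every ray starting from $x_0$ intersects $\partial\Omega$ at only one point; it is star-shaped with respect to a ball $B\subset\Omega$ if it is star-shaped with respect to every point of $B$. In this case the degree-$0$ homogeneous positive function $\varphi$ describing $\partial\Omega=\{|x|=\varphi(x)\}$ is Lipschitz on the unit sphere. The space $W^{1,p}_0(|x|^{l(1-p)},\Omega)$ is the completion of $C_0^\infty(\Omega)$ with respect to the norm $\left(\int_\Omega|x|^{l(1-p)}|\nabla u|^pdx\right)^{1/p}$. Values of $u$ on $S_\varepsilon$ are understood in the trace sense. *)

theory Defs
  imports "HOL-Analysis.Analysis"
begin

definition domain :: "(real ^ 'n) set \<Rightarrow> bool" where
  "domain \<Omega> \<longleftrightarrow> open \<Omega> \<and> connected \<Omega> \<and> \<Omega> \<noteq> {}"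

text \<open>Near each boundary point, the domain is the region below a continuous graph over the
  hyperplane orthogonal to some unit vector \<open>e\<close>.\<close>

definition C0_boundary :: "(real ^ 'n) set \<Rightarrow> bool" where
  "C0_boundary \<Omega> \<longleftrightarrow>
     (\<forall>z\<in>frontier \<Omega>. \<exists>e f r. norm e = 1 \<and> 0 < r \<and> continuous_on UNIV (f :: real ^ 'n \<Rightarrow> real) \<and>
        (\<forall>x\<in>ball z r. x \<in> \<Omega> \<longleftrightarrow> x \<bullet> e < f (x - (x \<bullet> e) *\<^sub>R e)))"

definition star_shaped_point :: "(real ^ 'n) set \<Rightarrow> real ^ 'n \<Rightarrow> bool" where
  "star_shaped_point \<Omega> x0 \<longleftrightarrow>
     domain \<Omega> \<and> bounded \<Omega> \<and> C0_boundary \<Omega> \<and> x0 \<in> \<Omega> \<and>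
     (\<forall>d. d \<noteq> 0 \<longrightarrow> (\<exists>!y. y \<in> frontier \<Omega> \<and> (\<exists>t\<ge>0. y = x0 + t *\<^sub>R d)))"

definition star_shaped_ball :: "(real ^ 'n) set \<Rightarrow> (real ^ 'n) set \<Rightarrow> bool" where
  "star_shaped_ball \<Omega> B \<longleftrightarrow> B \<subseteq> \<Omega> \<and> (\<forall>x0\<in>B. star_shaped_point \<Omega> x0)"

definition homogeneous0 :: "(real ^ 'n \<Rightarrow> real) \<Rightarrow> bool" where
  "homogeneous0 \<phi> \<longleftrightarrow> (\<forall>t x. 0 < t \<longrightarrow> \<phi> (t *\<^sub>R x) = \<phi> x)"

definition gradient :: "(real ^ 'n \<Rightarrow> real) \<Rightarrow> real ^ 'n \<Rightarrow> real ^ 'n" where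
  "gradient f x = (THE D. GDERIV f x :> D)"

primrec C_class :: "nat \<Rightarrow> (real ^ 'n \<Rightarrow> real) \<Rightarrow> bool" where
  "C_class 0 f \<longleftrightarrow> continuous_on UNIV f"
| "C_class (Suc k) f \<longleftrightarrow>
     (\<forall>x. f differentiable (at x)) \<and> (\<forall>i. C_class k (\<lambda>x. gradient f x $ i))"

text \<open>The class \<open>C\<^sub>0\<^sup>\<infinity>(\<Omega>)\<close>; functions are extended by zero outside \<open>\<Omega>\<close>.\<close>

definition test_function :: "(real ^ 'n) set \<Rightarrow> (real ^ 'n \<Rightarrow> real) \<Rightarrow> bool" where
  "test_function \<Omega> v \<longleftrightarrow>
     (\<forall>k. C_class k v) \<and> compact (closure {x. v x \<noteq> 0}) \<and> closure {x. v x \<noteq> 0} \<subseteq> \<Omega>"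

text \<open>The \<open>p\<close>-th power of the norm, of a vector field \<open>F\<close> in the role of \<open>\<nabla>u\<close>.\<close>

definition weighted_energy ::
    "real \<Rightarrow> real \<Rightarrow> (real ^ 'n) set \<Rightarrow> (real ^ 'n \<Rightarrow> real ^ 'n) \<Rightarrow> ennreal" where
  "weighted_energy p l \<Omega> F =
     (\<integral>\<^sup>+x. ennreal (norm x powr (l * (1 - p)) * norm (F x) powr p) \<partial>lebesgue_on \<Omega>)"

text \<open>The completion of \<open>C\<^sub>0\<^sup>\<infinity>(\<Omega>)\<close> is realised by functions: the element represented by a Cauchy
  sequence \<open>v\<close> of test functions is the pair of its \<open>L\<^sup>1(\<Omega>)\<close> limit \<open>u\<close> and the limit \<open>G\<close> of the
  gradients in the weighted norm. For bounded \<open>\<Omega>\<close>, \<open>p > 1\<close> and \<open>l > (n - p) / (p - 1)\<close> (which is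
  above \<open>-n\<close>), Hoelder's inequality bounds the unweighted \<open>L\<^sup>1\<close> norm of the gradient by the
  weighted norm, so by Poincare's inequality every Cauchy sequence converges in \<open>L\<^sup>1(\<Omega>)\<close>, and
  \<open>G\<close> is the weak gradient of \<open>u\<close>, determined almost everywhere by \<open>u\<close>.\<close>

definition approximates ::
    "real \<Rightarrow> real \<Rightarrow> (real ^ 'n) set \<Rightarrow> (nat \<Rightarrow> real ^ 'n \<Rightarrow> real) \<Rightarrow>
     (real ^ 'n \<Rightarrow> real) \<Rightarrow> (real ^ 'n \<Rightarrow> real ^ 'n) \<Rightarrow> bool" where
  "approximates p l \<Omega> v u G \<longleftrightarrow>
     (\<forall>k. test_function \<Omega> (v k)) \<and>
     (\<lambda>k. \<integral>\<^sup>+x. ennreal \<bar>v k x - u x\<bar> \<partial>lebesgue_on \<Omega>) \<longlonglongrightarrow> 0 \<and>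
     (\<lambda>k. weighted_energy p l \<Omega> (\<lambda>x. gradient (v k) x - G x)) \<longlonglongrightarrow> 0"

definition W0_with_gradient ::
    "real \<Rightarrow> real \<Rightarrow> (real ^ 'n) set \<Rightarrow> (real ^ 'n \<Rightarrow> real) \<Rightarrow> (real ^ 'n \<Rightarrow> real ^ 'n) \<Rightarrow> bool" where
  "W0_with_gradient p l \<Omega> u G \<longleftrightarrow>
     u \<in> borel_measurable (lebesgue_on \<Omega>) \<and> G \<in> borel_measurable (lebesgue_on \<Omega>) \<and>
     (\<exists>v. approximates p l \<Omega> v u G)"

text \<open>Surface measure on the sphere \<open>{|x| = r}\<close> of radius \<open>r > 0\<close>, as a Borel measure on the whole
  space, by the cone formula: the surface of \<open>A \<subseteq> {|x| = r}\<close> is \<open>n / r\<close> times the volume of the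
  cone \<open>{s *\<^sub>R a | a \<in> A, 0 < s < 1}\<close>.\<close>

definition sphere_measure :: "real \<Rightarrow> (real ^ 'n) measure" where
  "sphere_measure r =
     scale_measure (ennreal (real CARD('n) / r))
       (distr (restrict_space lborel (ball 0 r)) borel (\<lambda>x. (r / norm x) *\<^sub>R x))"

text \<open>The trace on a sphere is the extension by continuity of the restriction map from test functions
  to \<open>L\<^sup>p\<close> of the sphere.\<close>

definition trace_on_sphere ::
    "real \<Rightarrow> real \<Rightarrow> (real ^ 'n) set \<Rightarrow> (real ^ 'n \<Rightarrow> real) \<Rightarrow> (real ^ 'n \<Rightarrow> real ^ 'n) \<Rightarrow>
     real \<Rightarrow> (real ^ 'n \<Rightarrow> real) \<Rightarrow> bool" where
  "trace_on_sphere p l \<Omega> u G \<epsilon> T \<longleftrightarrow>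
     T \<in> borel_measurable borel \<and>
     (\<exists>v. approximates p l \<Omega> v u G \<and>
        (\<lambda>k. \<integral>\<^sup>+x. ennreal (\<bar>v k x - T x\<bar> powr p) \<partial>sphere_measure \<epsilon>) \<longlonglongrightarrow> 0)"

end

theory Submission
  imports Defs
begin

text \<open>
  Put \<open>a = m + l\<close> and \<open>r = |x|\<close>. Integrating the radial derivative of
  \<open>|u| powr p * (\<phi> powr a - r powr a) powr (1 - p)\<close> over the part \<open>\<epsilon> \<le> r < \<phi>\<close> of a ray produces
  the Hardy term and a boundary term on the sphere of radius \<open>\<epsilon>\<close>; the remaining mixed term is bounded
  by Young's inequality with a free parameter \<open>\<mu>\<close>. Unlike Hoelder's inequality this keeps the estimate
  additive, so it can be integrated over the directions in polar coordinates. The result passes from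
  test functions to \<open>u\<close> for each fixed \<open>\<epsilon>\<close>, since the estimate itself with \<open>\<mu> = a / 2\<close> bounds the
  Hardy term of a difference of test functions by its energy. Optimising \<open>\<mu>\<close> and letting \<open>\<epsilon>\<close> tend
  to \<open>0\<close> finishes the proof.
\<close>

section \<open>Integration in polar coordinates\<close>

lemma nn_integral_lborel_scaleR:
  fixes f :: "'a::euclidean_space \<Rightarrow> ennreal"
  assumes [measurable]: "f \<in> borel_measurable borel" and "0 < c"
  shows "(\<integral>\<^sup>+x. f x \<partial>lborel) = ennreal (c ^ DIM('a)) * (\<integral>\<^sup>+x. f (c *\<^sub>R x) \<partial>lborel)"
  using assms(2)
  by (subst lborel_affine[of c 0])
     (simp_all add: nn_integral_density nn_integral_distr nn_integral_cmult ennreal_power)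

lemma nn_integral_power_tail:
  fixes N :: nat and b :: real
  assumes "0 < b" "1 \<le> N"
  shows "(\<integral>\<^sup>+s. ennreal (1 / s ^ (N + 1)) * indicator {b<..} s \<partial>lborel) = ennreal (1 / (N * b ^ N))"
proof -
  have "(\<integral>\<^sup>+s. ennreal (1 / s ^ (N + 1)) * indicator {b<..} s \<partial>lborel)
      = (\<integral>\<^sup>+s. ennreal (1 / s ^ (N + 1)) * indicator {b..} s \<partial>lborel)"
    by (rule nn_integral_cong_AE, rule AE_mp[OF AE_lborel_singleton[of b]], rule AE_I2)
       (auto simp: indicator_def)
  also have "\<dots> = ennreal (0 - (- (1 / (N * b ^ N))))"
  proof (rule nn_integral_FTC_atLeast)
    fix x :: real
    assume x: "b \<le> x"
    show "((\<lambda>s. - (1 / (real N * s ^ N))) has_real_derivative 1 / x ^ (N + 1)) (at x)"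
    proof -
      obtain M where M: "N = Suc M" using assms(2) by (cases N) auto
      have "x ^ M + real M * x ^ (M - Suc 0) * x = real (Suc M) * x ^ M"
        by (cases M) (auto simp: algebra_simps)
      then show ?thesis
        unfolding M using x assms(1)
        by (auto intro!: derivative_eq_intros simp: divide_simps simp del: of_nat_Suc)
    qed
    show "0 \<le> 1 / x ^ (N + 1)" using x assms(1) by simp
  next
    have "filterlim (\<lambda>s. real N * s ^ N) at_top at_top"
      using assms(2) by (intro filterlim_tendsto_pos_mult_at_top[OF tendsto_const]
        filterlim_pow_at_top filterlim_ident) auto
    then have "((\<lambda>s. 1 / (real N * s ^ N)) \<longlongrightarrow> 0) at_top"
      by (intro tendsto_divide_0[OF tendsto_const] filterlim_at_top_imp_at_infinity)
    from tendsto_minus[OF this] show "((\<lambda>s. - (1 / (real N * s ^ N))) \<longlongrightarrow> 0) at_top"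
      by simp
  qed measurable
  finally show ?thesis by simp
qed

text \<open>Substituting \<open>r = s|x|\<close> in the inner integral of the right-hand side and then
  \<open>y = sx\<close> reduces it to \<open>\<integral>F(y)|y|\<^sup>N \<integral>\<^sub>s\<^sub>>\<^sub>|\<^sub>y\<^sub>| s\<^sup>-\<^sup>N\<^sup>-\<^sup>1 ds dy\<close>.\<close>

lemma nn_integral_polar:
  fixes F :: "'a::euclidean_space \<Rightarrow> ennreal"
  assumes [measurable]: "F \<in> borel_measurable borel"
  shows "(\<integral>\<^sup>+x. F x \<partial>lborel) = ennreal (DIM('a)) *
    (\<integral>\<^sup>+x. (\<integral>\<^sup>+r. F ((r / norm x) *\<^sub>R x) * ennreal (r ^ (DIM('a) - 1)) * indicator {0<..} r \<partial>lborel)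
       * indicator (ball 0 1) x \<partial>lborel)"
proof -
  let ?N = "DIM('a)"
  have [measurable]: "ball 0 s \<in> sets (borel :: 'a measure)" for s
    by simp
  have AE0: "AE x in lborel. (x::'a) \<noteq> 0"
    by (rule AE_lborel_singleton)
  have inner: "(\<integral>\<^sup>+r. F ((r / norm x) *\<^sub>R x) * ennreal (r ^ (?N - 1)) * indicator {0<..} r \<partial>lborel)
     = (\<integral>\<^sup>+s. F (s *\<^sub>R x) * ennreal (s ^ (?N - 1) * norm x ^ ?N) * indicator {0<..} s \<partial>lborel)"
    if "x \<noteq> 0" for x :: 'a
  proof -
    have "(\<integral>\<^sup>+r. F ((r / norm x) *\<^sub>R x) * ennreal (r ^ (?N - 1)) * indicator {0<..} r \<partial>lborel)
       = ennreal (norm x) * (\<integral>\<^sup>+s. F (s *\<^sub>R x) * ennreal ((norm x * s) ^ (?N - 1)) * indicator {0<..} s \<partial>lborel)"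
      using that
      by (subst nn_integral_real_affine[where c = "norm x" and t = 0])
         (auto simp: indicator_def zero_less_mult_iff intro!: arg_cong[where f = "\<lambda>t. _ * t"] nn_integral_cong)
    also have "\<dots> = (\<integral>\<^sup>+s. ennreal (norm x) * (F (s *\<^sub>R x) * ennreal ((norm x * s) ^ (?N - 1)) * indicator {0<..} s) \<partial>lborel)"
      by (subst nn_integral_cmult) auto
    also have "\<dots> = (\<integral>\<^sup>+s. F (s *\<^sub>R x) * ennreal (s ^ (?N - 1) * norm x ^ ?N) * indicator {0<..} s \<partial>lborel)"
    proof (intro nn_integral_cong)
      fix s :: real
      obtain M where M: "?N = Suc M" using DIM_positive[where 'a='a] by (cases ?N) auto
      have "ennreal (norm x) * ennreal ((norm x * s) ^ (?N - 1)) = ennreal (s ^ (?N - 1) * norm x ^ ?N)"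
        if "s > 0"
        unfolding M using that by (simp add: ennreal_mult[symmetric] power_mult_distrib mult_ac)
      moreover have "ennreal (norm x) * (F (s *\<^sub>R x) * ennreal ((norm x * s) ^ (?N - 1)) * indicator {0<..} s)
          = F (s *\<^sub>R x) * (ennreal (norm x) * ennreal ((norm x * s) ^ (?N - 1))) * indicator {0<..} s"
        by (simp only: ac_simps)
      ultimately show "ennreal (norm x) * (F (s *\<^sub>R x) * ennreal ((norm x * s) ^ (?N - 1)) * indicator {0<..} s)
          = F (s *\<^sub>R x) * ennreal (s ^ (?N - 1) * norm x ^ ?N) * indicator {0<..} s"
        by (cases "s > 0") auto
    qed
    finally show ?thesis .
  qed
  have outer: "(\<integral>\<^sup>+x. F (s *\<^sub>R x) * ennreal (s ^ (?N - 1) * norm x ^ ?N) * indicator {0<..} s * indicator (ball 0 1) x \<partial>lborel)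
     = (\<integral>\<^sup>+y. F y * ennreal (norm y ^ ?N) * (ennreal (1 / s ^ (?N + 1)) * indicator (ball 0 s) y) \<partial>lborel)"
    (is "?l = ?r") for s :: real
  proof (cases "s > 0")
    case True
    have "?r = ennreal (s ^ ?N) * (\<integral>\<^sup>+x. F (s *\<^sub>R x) * ennreal (norm (s *\<^sub>R x) ^ ?N) * (ennreal (1 / s ^ (?N + 1)) * indicator (ball 0 s) (s *\<^sub>R x)) \<partial>lborel)"
      by (rule nn_integral_lborel_scaleR[OF _ True]) measurable
    also have "\<dots> = (\<integral>\<^sup>+x. ennreal (s ^ ?N) * (F (s *\<^sub>R x) * ennreal (norm (s *\<^sub>R x) ^ ?N) * (ennreal (1 / s ^ (?N + 1)) * indicator (ball 0 s) (s *\<^sub>R x))) \<partial>lborel)"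
      by (subst nn_integral_cmult) auto
    also have "\<dots> = ?l"
    proof (intro nn_integral_cong)
      fix x :: 'a
      obtain M where M: "?N = Suc M" using DIM_positive[where 'a='a] by (cases ?N) auto
      have "s ^ ?N * (norm (s *\<^sub>R x) ^ ?N * (1 / s ^ (?N + 1))) = s ^ (?N - 1) * norm x ^ ?N"
        unfolding M using True by (simp add: power_mult_distrib divide_simps)
      then have "ennreal (s ^ ?N) * (ennreal (norm (s *\<^sub>R x) ^ ?N) * ennreal (1 / s ^ (?N + 1))) = ennreal (s ^ (?N - 1) * norm x ^ ?N)"
        using True by (simp add: ennreal_mult[symmetric])
      moreover have "indicator (ball 0 s) (s *\<^sub>R x) = (indicator (ball 0 1) x :: ennreal)"
        using True by (auto simp: indicator_def)
      moreover have "ennreal (s ^ ?N) * (F (s *\<^sub>R x) * ennreal (norm (s *\<^sub>R x) ^ ?N) * (ennreal (1 / s ^ (?N + 1)) * indicator (ball 0 s) (s *\<^sub>R x)))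
        = F (s *\<^sub>R x) * (ennreal (s ^ ?N) * (ennreal (norm (s *\<^sub>R x) ^ ?N) * ennreal (1 / s ^ (?N + 1)))) * indicator (ball 0 s) (s *\<^sub>R x)"
        by (simp only: ac_simps)
      ultimately show "ennreal (s ^ ?N) * (F (s *\<^sub>R x) * ennreal (norm (s *\<^sub>R x) ^ ?N) * (ennreal (1 / s ^ (?N + 1)) * indicator (ball 0 s) (s *\<^sub>R x)))
        = F (s *\<^sub>R x) * ennreal (s ^ (?N - 1) * norm x ^ ?N) * indicator {0<..} s * indicator (ball 0 1) x"
        using True by simp
    qed
    finally show ?thesis by simp
  next
    case False
    then have "?r = (\<integral>\<^sup>+y. 0 \<partial>(lborel :: 'a measure))"
      by (intro nn_integral_cong) (auto simp: indicator_def dest: le_less_trans[OF norm_ge_zero])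
    then show ?thesis using False by simp
  qed
  have "(\<integral>\<^sup>+x. (\<integral>\<^sup>+r. F ((r / norm x) *\<^sub>R x) * ennreal (r ^ (?N - 1)) * indicator {0<..} r \<partial>lborel)
       * indicator (ball 0 1) x \<partial>lborel)
    = (\<integral>\<^sup>+x. (\<integral>\<^sup>+s. F (s *\<^sub>R x) * ennreal (s ^ (?N - 1) * norm x ^ ?N) * indicator {0<..} s * indicator (ball 0 1) x \<partial>lborel) \<partial>lborel)"
    by (rule nn_integral_cong_AE, rule AE_mp[OF AE0], rule AE_I2)
       (simp add: inner[unfolded One_nat_def] nn_integral_multc)
  also have "\<dots> = (\<integral>\<^sup>+s. (\<integral>\<^sup>+x. F (s *\<^sub>R x) * ennreal (s ^ (?N - 1) * norm x ^ ?N) * indicator {0<..} s * indicator (ball 0 1) x \<partial>lborel) \<partial>lborel)"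
    by (rule lborel_pair.Fubini') measurable
  also have "\<dots> = (\<integral>\<^sup>+s. (\<integral>\<^sup>+y. F y * ennreal (norm y ^ ?N) * (ennreal (1 / s ^ (?N + 1)) * indicator {p. norm (fst p) < snd p} (y, s)) \<partial>lborel) \<partial>lborel)"
    unfolding outer by (intro nn_integral_cong) (auto simp: indicator_def)
  also have "\<dots> = (\<integral>\<^sup>+y. (\<integral>\<^sup>+s. F y * ennreal (norm y ^ ?N) * (ennreal (1 / s ^ (?N + 1)) * indicator {p. norm (fst p) < snd p} (y, s)) \<partial>lborel) \<partial>lborel)"
    by (rule lborel_pair.Fubini') measurable
  also have "\<dots> = (\<integral>\<^sup>+y. F y * ennreal (norm y ^ ?N) * (\<integral>\<^sup>+s. ennreal (1 / s ^ (?N + 1)) * indicator {norm y<..} s \<partial>lborel) \<partial>lborel)"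
    by (intro nn_integral_cong, subst nn_integral_cmult[symmetric])
       (auto simp: indicator_def intro!: nn_integral_cong)
  also have "\<dots> = (\<integral>\<^sup>+y. F y * ennreal (1 / ?N) \<partial>lborel)"
  proof (rule nn_integral_cong_AE, rule AE_mp[OF AE0], rule AE_I2, rule impI)
    fix y :: 'a
    assume "y \<noteq> 0"
    then have "ennreal (norm y ^ ?N) * ennreal (1 / (?N * norm y ^ ?N)) = ennreal (1 / ?N)"
      by (simp add: ennreal_mult[symmetric])
    with \<open>y \<noteq> 0\<close> show "F y * ennreal (norm y ^ ?N) * (\<integral>\<^sup>+s. ennreal (1 / s ^ (?N + 1)) * indicator {norm y<..} s \<partial>lborel) = F y * ennreal (1 / ?N)"
      by (subst nn_integral_power_tail) (auto simp: mult.assoc Suc_le_eq)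
  qed
  also have "\<dots> = (\<integral>\<^sup>+y. F y \<partial>lborel) * ennreal (1 / ?N)"
    by (rule nn_integral_multc) simp
  also have "ennreal (real ?N) * \<dots> = (\<integral>\<^sup>+y. F y \<partial>lborel) * (ennreal (real ?N) * ennreal (1 / ?N))"
    by (simp add: mult_ac)
  also have "ennreal (real ?N) * ennreal (1 / ?N) = 1"
    by (simp add: ennreal_mult[symmetric])
  finally show ?thesis by simp
qed

lemma sets_sphere_measure[measurable_cong, simp]: "sets (sphere_measure r) = sets borel"
  by (simp add: sphere_measure_def)

lemma nn_integral_sphere_measure:
  fixes g :: "real ^ 'n \<Rightarrow> ennreal"
  assumes [measurable]: "g \<in> borel_measurable borel" and r: "0 < r"
  shows "ennreal (r powr (1 - real CARD('n))) * (\<integral>\<^sup>+x. g x \<partial>sphere_measure r) =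
    ennreal (real CARD('n)) * (\<integral>\<^sup>+x. g ((r / norm x) *\<^sub>R x) * indicator (ball 0 1) x \<partial>lborel)"
proof -
  let ?N = "CARD('n)"
  have "(\<integral>\<^sup>+x. g x \<partial>sphere_measure r)
     = ennreal (?N / r) * (\<integral>\<^sup>+x. g ((r / norm x) *\<^sub>R x) * indicator (ball 0 r) x \<partial>lborel)"
    unfolding sphere_measure_def
    by (simp add: nn_integral_scale_measure nn_integral_distr nn_integral_restrict_space measurable_restrict_space1)
  also have "(\<integral>\<^sup>+x. g ((r / norm x) *\<^sub>R x) * indicator (ball 0 r) x \<partial>lborel)
     = ennreal (r ^ ?N) * (\<integral>\<^sup>+x. g ((r / norm x) *\<^sub>R x) * indicator (ball 0 1) x \<partial>lborel)"
    using r by (subst nn_integral_lborel_scaleR[OF _ r])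
       (auto simp: indicator_def intro!: arg_cong[where f = "\<lambda>t. _ * t"] nn_integral_cong)
  finally have "ennreal (r powr (1 - real ?N)) * (\<integral>\<^sup>+x. g x \<partial>sphere_measure r) =
     (ennreal (r powr (1 - real ?N)) * (ennreal (?N / r) * ennreal (r ^ ?N))) * (\<integral>\<^sup>+x. g ((r / norm x) *\<^sub>R x) * indicator (ball 0 1) x \<partial>lborel)"
    by (simp add: mult_ac)
  also have "ennreal (r powr (1 - real ?N)) * (ennreal (?N / r) * ennreal (r ^ ?N)) = ennreal ?N"
    using r by (simp add: ennreal_mult[symmetric] powr_diff powr_realpow)
  finally show ?thesis .
qed

section \<open>The inequality on a ray\<close>

lemma young_scaled:
  fixes p y z \<mu> :: real
  assumes p: "1 < p" and "0 < \<mu>" "0 \<le> y" "0 \<le> z"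
  shows "p * (y * z powr (p - 1)) \<le> \<mu> powr (1 - p) * y powr p + (p - 1) * \<mu> * z powr p"
proof -
  define q where "q = p / (p - 1)"
  define c where "c = \<mu> powr ((1 - p) / p) * y"
  define d where "d = \<mu> powr ((p - 1) / p) * z powr (p - 1)"
  have q: "1 < q" "1 / p + 1 / q = 1"
    using p by (auto simp: q_def field_simps)
  have "c * d \<le> c powr p / p + d powr q / q"
    using p q assms by (intro Youngs_inequality) (auto simp: c_def d_def)
  moreover have "c * d = y * z powr (p - 1)"
  proof -
    have "\<mu> powr ((1 - p) / p) * \<mu> powr ((p - 1) / p) = 1"
      using assms by (simp add: powr_add[symmetric] add_divide_distrib[symmetric])
    then show ?thesis
      by (simp add: c_def d_def mult_ac)
  qed
  moreover have "c powr p = \<mu> powr (1 - p) * y powr p"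
    using assms by (simp add: c_def powr_mult powr_powr)
  moreover have "d powr q = \<mu> * z powr p"
    using assms by (simp add: d_def powr_mult powr_powr q_def)
  ultimately have "p * (y * z powr (p - 1)) \<le> p * (\<mu> powr (1 - p) * y powr p / p + \<mu> * z powr p / q)"
    using p by (intro mult_left_mono) auto
  also have "\<dots> = \<mu> powr (1 - p) * y powr p + (p - 1) * \<mu> * z powr p"
    using p by (simp add: q_def field_simps)
  finally show ?thesis .
qed

lemma has_real_derivative_abs_powr:
  fixes p x :: real
  assumes p: "1 < p"
  shows "((\<lambda>x. \<bar>x\<bar> powr p) has_real_derivative p * \<bar>x\<bar> powr (p - 1) * sgn x) (at x)"
proof (cases "x = 0")
  case False
  then consider "0 < x" | "x < 0" by linarith
  then show ?thesis
  proof cases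
    case 1
    then have "((\<lambda>x. x powr p) has_real_derivative p * x powr (p - 1)) (at x)"
      by (intro has_real_derivative_powr)
    then show ?thesis
      by (rule has_field_derivative_transform_within_open[where S = "{0<..}", THEN DERIV_cong])
         (use 1 in simp_all)
  next
    case 2
    then have "((\<lambda>x. (- x) powr p) has_real_derivative - (p * (- x) powr (p - 1))) (at x)"
      by (auto intro!: derivative_eq_intros simp: powr_diff)
    then show ?thesis
      by (rule has_field_derivative_transform_within_open[where S = "{..<0}", THEN DERIV_cong])
         (use 2 in simp_all)
  qed
next
  case True
  have "((\<lambda>h. \<bar>h\<bar> powr (p - 1)) \<longlongrightarrow> 0) (at (0::real))"
    using p by (auto intro!: tendsto_eq_intros)
  moreover have "\<bar>\<bar>h\<bar> powr p / h\<bar> = \<bar>h\<bar> powr (p - 1)" for h :: real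
    by (simp add: abs_divide powr_diff)
  ultimately have "((\<lambda>h. \<bar>h\<bar> powr p / h) \<longlongrightarrow> 0) (at (0::real))"
    by (subst tendsto_rabs_zero_iff[symmetric]) simp
  then show ?thesis
    using True p by (simp add: DERIV_def)
qed

lemma continuous_on_abs_powr:
  fixes f :: "'a::topological_space \<Rightarrow> real"
  assumes "continuous_on S f" "0 < p"
  shows "continuous_on S (\<lambda>x. \<bar>f x\<bar> powr p)"
  using assms by (intro continuous_on_powr' continuous_intros) auto

lemma nn_integral_Icc_eq_integral:
  fixes f :: "real \<Rightarrow> real"
  assumes "continuous_on {a..b} f" "\<And>x. x \<in> {a..b} \<Longrightarrow> 0 \<le> f x"
  shows "(\<integral>\<^sup>+x. ennreal (f x) * indicator {a..b} x \<partial>lborel) = ennreal (integral {a..b} f)"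
proof -
  have "(f has_integral integral {a..b} f) {a..b}"
    using assms(1) by (intro integrable_integral integrable_continuous_interval)
  from nn_integral_has_integral_lebesgue[OF assms(2) this]
  have "(\<integral>\<^sup>+x. ennreal (indicator {a..b} x * f x) \<partial>lborel) = ennreal (integral {a..b} f)" by simp
  moreover have "ennreal (indicator {a..b} x * f x) = ennreal (f x) * indicator {a..b} x" for x
    by (auto simp: indicator_def)
  ultimately show ?thesis by simp
qed

lemma hardy_on_ray:
  fixes h h' :: "real \<Rightarrow> real" and a p \<mu> \<epsilon> R R0 :: real
  defines "k \<equiv> \<lambda>r. \<bar>h r\<bar> powr p * r powr (a - 1) / (R powr a - r powr a) powr p"
  assumes a: "0 < a" and p: "1 < p" and lam: "0 < \<mu>"
    and \<epsilon>: "0 < \<epsilon>" "\<epsilon> < R0" and R: "R0 < R"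
    and h: "\<And>r. (h has_real_derivative h' r) (at r)"
    and h': "continuous_on UNIV h'"
    and h0: "\<And>r. R0 \<le> r \<Longrightarrow> r < R \<Longrightarrow> h r = 0"
  shows "(\<integral>\<^sup>+r. ennreal (a * (p - 1) * k r) * indicator {\<epsilon>..<R} r \<partial>lborel)
      + ennreal (\<bar>h \<epsilon>\<bar> powr p * (R powr a - \<epsilon> powr a) powr (1 - p))
    \<le> (\<integral>\<^sup>+r. ennreal (\<mu> powr (1 - p) * (r powr ((1 - a) * (p - 1)) * \<bar>h' r\<bar> powr p)
          + (p - 1) * \<mu> * k r) * indicator {\<epsilon>..<R} r \<partial>lborel)"
proof -
  define Q where "Q = (\<lambda>r. \<mu> powr (1 - p) * (r powr ((1 - a) * (p - 1)) * \<bar>h' r\<bar> powr p) + (p - 1) * \<mu> * k r)"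
  define \<Psi> where "\<Psi> = (\<lambda>r. \<bar>h r\<bar> powr p * (R powr a - r powr a) powr (1 - p))"
  define \<Psi>' where "\<Psi>' = (\<lambda>r. p * \<bar>h r\<bar> powr (p - 1) * sgn (h r) * h' r * (R powr a - r powr a) powr (1 - p)
     + a * (p - 1) * k r)"
  have D: "0 < R powr a - r powr a" if "r \<in> {\<epsilon>..R0}" for r
    using that \<epsilon> R a by (simp add: powr_less_mono2)
  have h_cont: "continuous_on S h" for S
    using h by (meson DERIV_continuous_on continuous_on_subset has_field_derivative_at_within)
  have powr_cont: "continuous_on {\<epsilon>..R0} (\<lambda>r. r powr b)" for b
    using \<epsilon> by (intro continuous_on_powr continuous_on_id continuous_on_const) auto
  have D_cont: "continuous_on {\<epsilon>..R0} (\<lambda>r. (R powr a - r powr a) powr p)"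
    using D by (intro continuous_on_powr continuous_on_diff continuous_on_const powr_cont)
      (auto simp: less_imp_neq[symmetric])
  have k_cont: "continuous_on {\<epsilon>..R0} k"
    unfolding k_def using D p
    by (intro continuous_on_divide continuous_on_mult continuous_on_abs_powr h_cont powr_cont D_cont)
       (auto simp: less_imp_neq[symmetric])
  have Q_cont: "continuous_on {\<epsilon>..R0} Q"
    unfolding Q_def using p
    by (intro continuous_on_add continuous_on_mult continuous_on_const continuous_on_abs_powr
        powr_cont k_cont continuous_on_subset[OF h']) auto
  have k_nonneg: "0 \<le> k r" for r
    by (auto simp: k_def)
  have Q_nonneg: "0 \<le> Q r" for r
    unfolding Q_def using k_nonneg p lam by (intro add_nonneg_nonneg mult_nonneg_nonneg) auto
  have deriv: "(\<Psi> has_real_derivative \<Psi>' r) (at r)" if r: "r \<in> {\<epsilon>..R0}" for r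
  proof -
    have d1: "((\<lambda>r. \<bar>h r\<bar> powr p) has_real_derivative p * \<bar>h r\<bar> powr (p - 1) * sgn (h r) * h' r) (at r)"
      by (rule DERIV_chain'[OF h has_real_derivative_abs_powr[OF p]])
    have "0 < r" using r \<epsilon> by auto
    then have d2: "((\<lambda>r. R powr a - r powr a) has_real_derivative - (a * r powr (a - 1))) (at r)"
      by (auto intro!: derivative_eq_intros)
    have d3: "((\<lambda>r. (R powr a - r powr a) powr (1 - p)) has_real_derivative
        ((1 - p) * (R powr a - r powr a) powr (1 - p - 1)) * - (a * r powr (a - 1))) (at r)"
      by (rule DERIV_chain'[OF d2 has_real_derivative_powr[OF D[OF r]]])
    have "(R powr a - r powr a) powr (1 - p - 1) = 1 / (R powr a - r powr a) powr p"
      by (simp add: powr_minus_divide)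
    then have "\<bar>h r\<bar> powr p * (((1 - p) * (R powr a - r powr a) powr (1 - p - 1)) * - (a * r powr (a - 1)))
       = a * (p - 1) * k r"
      by (simp add: k_def algebra_simps)
    note eq = this
    show ?thesis
      unfolding \<Psi>_def \<Psi>'_def
      by (rule DERIV_cong[OF DERIV_mult'[OF d1 d3]]) (simp only: eq add.commute)
  qed
  have FTC: "(\<Psi>' has_integral (\<Psi> R0 - \<Psi> \<epsilon>)) {\<epsilon>..R0}"
    using \<epsilon> deriv
    by (intro fundamental_theorem_of_calculus)
       (auto simp: has_real_derivative_iff_has_vector_derivative[symmetric] intro: has_field_derivative_at_within)
  have "\<Psi> R0 = 0"
    using h0[of R0] R by (simp add: \<Psi>_def)
  have le: "a * (p - 1) * k r \<le> \<Psi>' r + Q r" if r: "r \<in> {\<epsilon>..R0}" for r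
  proof -
    let ?D = "R powr a - r powr a"
    define y where "y = \<bar>h' r\<bar> * r powr ((1 - a) * (p - 1) / p)"
    define z where "z = \<bar>h r\<bar> * r powr ((a - 1) / p) / ?D"
    have r0: "0 < r" using r \<epsilon> by auto
    have nonneg: "0 \<le> y" "0 \<le> z" using D[OF r] by (auto simp: y_def z_def)
    have yp: "y powr p = r powr ((1 - a) * (p - 1)) * \<bar>h' r\<bar> powr p"
      using p r0 by (simp add: y_def powr_mult powr_powr)
    have zp: "z powr p = k r"
      using p r0 D[OF r] by (simp add: z_def k_def powr_mult powr_divide powr_powr)
    have zp1: "z powr (p - 1) = \<bar>h r\<bar> powr (p - 1) * r powr ((a - 1) * (p - 1) / p) * ?D powr (1 - p)"
      using p r0 D[OF r] powr_minus_divide[of ?D "p - 1"]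
      by (simp add: z_def powr_mult powr_divide powr_powr)
    have "r powr ((1 - a) * (p - 1) / p) * r powr ((a - 1) * (p - 1) / p) = 1"
      using r0 by (simp add: powr_add[symmetric] add_divide_distrib[symmetric] distrib_right[symmetric])
    then have yz: "y * z powr (p - 1) = \<bar>h' r\<bar> * \<bar>h r\<bar> powr (p - 1) * ?D powr (1 - p)"
      unfolding zp1 y_def by (simp add: mult_ac)
    have "- (sgn (h r) * h' r) \<le> \<bar>h' r\<bar>"
      by (auto simp: sgn_if)
    then have "(p * \<bar>h r\<bar> powr (p - 1) * ?D powr (1 - p)) * - (sgn (h r) * h' r)
        \<le> (p * \<bar>h r\<bar> powr (p - 1) * ?D powr (1 - p)) * \<bar>h' r\<bar>"
      using p by (intro mult_left_mono) auto
    also have "\<dots> = p * (y * z powr (p - 1))"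
      by (simp add: yz mult_ac)
    also have "\<dots> \<le> Q r"
      using young_scaled[OF p lam nonneg] by (simp add: Q_def yp zp)
    finally show ?thesis
      by (simp add: \<Psi>'_def mult_ac)
  qed
  have k_int: "((\<lambda>r. a * (p - 1) * k r) has_integral integral {\<epsilon>..R0} (\<lambda>r. a * (p - 1) * k r)) {\<epsilon>..R0}"
    by (intro integrable_integral integrable_continuous_interval continuous_intros k_cont)
  have Q_int: "(Q has_integral integral {\<epsilon>..R0} Q) {\<epsilon>..R0}"
    by (intro integrable_integral integrable_continuous_interval Q_cont)
  have main: "integral {\<epsilon>..R0} (\<lambda>r. a * (p - 1) * k r) + \<Psi> \<epsilon> \<le> integral {\<epsilon>..R0} Q"
    using has_integral_le[OF k_int has_integral_add[OF FTC Q_int] le] \<open>\<Psi> R0 = 0\<close> by simp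
  have k_eq: "(\<integral>\<^sup>+r. ennreal (a * (p - 1) * k r) * indicator {\<epsilon>..<R} r \<partial>lborel)
    = ennreal (integral {\<epsilon>..R0} (\<lambda>r. a * (p - 1) * k r))"
  proof -
    have "(\<integral>\<^sup>+r. ennreal (a * (p - 1) * k r) * indicator {\<epsilon>..<R} r \<partial>lborel)
      = (\<integral>\<^sup>+r. ennreal (a * (p - 1) * k r) * indicator {\<epsilon>..R0} r \<partial>lborel)"
      using h0 R by (intro nn_integral_cong) (auto simp: indicator_def k_def)
    also have "\<dots> = ennreal (integral {\<epsilon>..R0} (\<lambda>r. a * (p - 1) * k r))"
      using a p k_nonneg by (intro nn_integral_Icc_eq_integral continuous_intros k_cont) auto
    finally show ?thesis .
  qed
  have "ennreal (integral {\<epsilon>..R0} Q) = (\<integral>\<^sup>+r. ennreal (Q r) * indicator {\<epsilon>..R0} r \<partial>lborel)"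
    using Q_nonneg Q_cont by (intro nn_integral_Icc_eq_integral[symmetric]) auto
  also have "\<dots> \<le> (\<integral>\<^sup>+r. ennreal (Q r) * indicator {\<epsilon>..<R} r \<partial>lborel)"
    using R by (intro nn_integral_mono) (auto simp: indicator_def)
  finally have Q_le: "ennreal (integral {\<epsilon>..R0} Q) \<le> (\<integral>\<^sup>+r. ennreal (Q r) * indicator {\<epsilon>..<R} r \<partial>lborel)" .
  have "0 \<le> integral {\<epsilon>..R0} (\<lambda>r. a * (p - 1) * k r)"
    using a p k_nonneg by (intro integral_nonneg integrable_continuous_interval continuous_intros k_cont) auto
  then have "ennreal (integral {\<epsilon>..R0} (\<lambda>r. a * (p - 1) * k r)) + ennreal (\<Psi> \<epsilon>) \<le> ennreal (integral {\<epsilon>..R0} Q)"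
    using ennreal_leI[OF main] by (subst ennreal_plus[symmetric]) (auto simp: \<Psi>_def)
  also note Q_le
  finally show ?thesis
    unfolding k_eq \<Psi>_def Q_def .
qed

section \<open>Limits in weighted spaces\<close>

lemma abs_add_powr_le:
  fixes x y p s :: real
  assumes p: "1 < p" and s: "0 < s" "s < 1"
  shows "\<bar>x + y\<bar> powr p \<le> (1 - s) powr (1 - p) * \<bar>x\<bar> powr p + s powr (1 - p) * \<bar>y\<bar> powr p"
proof -
  have ge1: "1 \<le> t powr (1 - p)" if "0 < t" "t < 1" for t :: real
    using powr_mono'[of "1 - p" 0 t] that p by simp
  have "\<bar>x + y\<bar> powr p \<le> (\<bar>x\<bar> + \<bar>y\<bar>) powr p"
    using p by (intro powr_mono2) auto
  also have "\<dots> \<le> (1 - s) powr (1 - p) * \<bar>x\<bar> powr p + s powr (1 - p) * \<bar>y\<bar> powr p"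
  proof (cases "x = 0 \<or> y = 0")
    case True
    then show ?thesis
      using ge1[OF s] ge1[of "1 - s"] s p mult_right_mono[of 1 _ "\<bar>x\<bar> powr p"] mult_right_mono[of 1 _ "\<bar>y\<bar> powr p"]
      by auto
  next
    case False
    have "((1 - s) *\<^sub>R (\<bar>x\<bar> / (1 - s)) + s *\<^sub>R (\<bar>y\<bar> / s)) powr p
       \<le> (1 - s) * (\<bar>x\<bar> / (1 - s)) powr p + s * (\<bar>y\<bar> / s) powr p"
      using p s False
      by (intro convex_onD[OF powr_convex]) auto
    also have "(1 - s) *\<^sub>R (\<bar>x\<bar> / (1 - s)) + s *\<^sub>R (\<bar>y\<bar> / s) = \<bar>x\<bar> + \<bar>y\<bar>"
      using s by simp
    also have "(1 - s) * (\<bar>x\<bar> / (1 - s)) powr p = (1 - s) powr (1 - p) * \<bar>x\<bar> powr p"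
      using s by (simp add: powr_divide powr_diff)
    also have "s * (\<bar>y\<bar> / s) powr p = s powr (1 - p) * \<bar>y\<bar> powr p"
      using s by (simp add: powr_divide powr_diff)
    finally show ?thesis .
  qed
  finally show ?thesis .
qed

lemma nn_integral_weighted_add_powr_le:
  fixes f g :: "'a \<Rightarrow> real"
  assumes [measurable]: "w \<in> borel_measurable M" "f \<in> borel_measurable M" "g \<in> borel_measurable M"
    and w: "\<And>x. 0 \<le> w x" and p: "1 < p" and s: "0 < s" "s < 1"
  shows "(\<integral>\<^sup>+x. ennreal (w x * \<bar>f x + g x\<bar> powr p) \<partial>M) \<le>
    ennreal ((1 - s) powr (1 - p)) * (\<integral>\<^sup>+x. ennreal (w x * \<bar>f x\<bar> powr p) \<partial>M) +
    ennreal (s powr (1 - p)) * (\<integral>\<^sup>+x. ennreal (w x * \<bar>g x\<bar> powr p) \<partial>M)"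
proof -
  have "(\<integral>\<^sup>+x. ennreal (w x * \<bar>f x + g x\<bar> powr p) \<partial>M) \<le>
    (\<integral>\<^sup>+x. ennreal ((1 - s) powr (1 - p)) * ennreal (w x * \<bar>f x\<bar> powr p) +
      ennreal (s powr (1 - p)) * ennreal (w x * \<bar>g x\<bar> powr p) \<partial>M)"
  proof (intro nn_integral_mono)
    fix x
    have "w x * \<bar>f x + g x\<bar> powr p \<le> w x * ((1 - s) powr (1 - p) * \<bar>f x\<bar> powr p + s powr (1 - p) * \<bar>g x\<bar> powr p)"
      by (intro mult_left_mono abs_add_powr_le p s w)
    then show "ennreal (w x * \<bar>f x + g x\<bar> powr p) \<le> ennreal ((1 - s) powr (1 - p)) * ennreal (w x * \<bar>f x\<bar> powr p) +
      ennreal (s powr (1 - p)) * ennreal (w x * \<bar>g x\<bar> powr p)"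
      using w[of x] by (simp add: ennreal_mult'[symmetric] ennreal_plus[symmetric] ennreal_leI algebra_simps del: ennreal_plus)
  qed
  also have "\<dots> = ennreal ((1 - s) powr (1 - p)) * (\<integral>\<^sup>+x. ennreal (w x * \<bar>f x\<bar> powr p) \<partial>M) +
    ennreal (s powr (1 - p)) * (\<integral>\<^sup>+x. ennreal (w x * \<bar>g x\<bar> powr p) \<partial>M)"
    by (simp add: nn_integral_add nn_integral_cmult)
  finally show ?thesis .
qed

lemma tendsto_nn_integral_weighted_powr:
  fixes f :: "nat \<Rightarrow> 'a \<Rightarrow> real"
  assumes [measurable]: "w \<in> borel_measurable M" "\<And>k. f k \<in> borel_measurable M" "g \<in> borel_measurable M"
    and w: "\<And>x. 0 \<le> w x" and p: "1 < p"
    and lim: "(\<lambda>k. \<integral>\<^sup>+x. ennreal (w x * \<bar>f k x - g x\<bar> powr p) \<partial>M) \<longlonglongrightarrow> 0"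
  shows "(\<lambda>k. \<integral>\<^sup>+x. ennreal (w x * \<bar>f k x\<bar> powr p) \<partial>M) \<longlonglongrightarrow> (\<integral>\<^sup>+x. ennreal (w x * \<bar>g x\<bar> powr p) \<partial>M)"
    (is "?a \<longlonglongrightarrow> ?b")
proof -
  define d where "d k = (\<integral>\<^sup>+x. ennreal (w x * \<bar>f k x - g x\<bar> powr p) \<partial>M)" for k
  define \<alpha> where "\<alpha> s = ennreal ((1 - s) powr (1 - p))" for s :: real
  define \<beta> where "\<beta> s = ennreal (s powr (1 - p))" for s :: real
  have up: "?a k \<le> \<alpha> s * ?b + \<beta> s * d k" if "0 < s" "s < 1" for k s
    using nn_integral_weighted_add_powr_le[of w M g "\<lambda>x. f k x - g x" p s] w p that
    by (simp add: d_def \<alpha>_def \<beta>_def)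
  have lo: "?b \<le> \<alpha> s * ?a k + \<beta> s * d k" if "0 < s" "s < 1" for k s
    using nn_integral_weighted_add_powr_le[of w M "f k" "\<lambda>x. g x - f k x" p s] w p that
    by (simp add: d_def \<alpha>_def \<beta>_def abs_minus_commute)
  have "d \<longlonglongrightarrow> 0"
    using lim by (simp add: d_def[abs_def])
  then have d0: "(\<lambda>k. \<beta> s * d k) \<longlonglongrightarrow> 0" for s
    using ennreal_tendsto_cmult[of "\<beta> s" d 0 sequentially] by (simp add: \<beta>_def)
  have \<alpha>1: "((\<lambda>s. \<alpha> s) \<longlongrightarrow> 1) (at_right 0)"
  proof -
    have "((\<lambda>s. (1 - s) powr (1 - p)) \<longlongrightarrow> (1 - 0) powr (1 - p)) (at_right 0)"
      by (intro tendsto_intros) auto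
    from tendsto_ennrealI[OF this] show ?thesis by (simp add: \<alpha>_def)
  qed
  have ev01: "eventually (\<lambda>s::real. 0 < s \<and> s < 1) (at_right 0)"
    unfolding eventually_at_right_field by (rule exI[of _ 1]) auto
  show ?thesis
  proof (rule order_tendstoI)
    fix y assume y: "?b < y"
    then have "?b < top" by (simp add: less_top[symmetric]) (metis top.not_eq_extremum less_trans)
    then have "((\<lambda>s. ?b * \<alpha> s) \<longlongrightarrow> ?b * 1) (at_right 0)"
      by (rule ennreal_tendsto_cmult[OF _ \<alpha>1])
    then have "((\<lambda>s. \<alpha> s * ?b) \<longlongrightarrow> ?b) (at_right 0)"
      by (simp add: mult.commute)
    from eventually_conj[OF ev01 order_tendstoD(2)[OF this y]]
    obtain s where s: "0 < s" "s < 1" "\<alpha> s * ?b < y"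
      by (metis (no_types, lifting) eventually_happens trivial_limit_at_right_real)
    have "(\<lambda>k. \<alpha> s * ?b + \<beta> s * d k) \<longlonglongrightarrow> \<alpha> s * ?b + 0"
      by (intro tendsto_add tendsto_const d0)
    then have "(\<lambda>k. \<alpha> s * ?b + \<beta> s * d k) \<longlonglongrightarrow> \<alpha> s * ?b" by simp
    from order_tendstoD(2)[OF this s(3)] show "eventually (\<lambda>k. ?a k < y) sequentially"
      by eventually_elim (rule le_less_trans[OF up[OF s(1,2)]])
  next
    fix y assume y: "y < ?b"
    then have "y < top" by (metis top.not_eq_extremum less_top leD top_greatest)
    then have "((\<lambda>s. y * \<alpha> s) \<longlongrightarrow> y * 1) (at_right 0)"
      by (rule ennreal_tendsto_cmult[OF _ \<alpha>1])
    then have "((\<lambda>s. \<alpha> s * y) \<longlongrightarrow> y) (at_right 0)"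
      by (simp add: mult.commute)
    from eventually_conj[OF ev01 order_tendstoD(2)[OF this y]]
    obtain s where s: "0 < s" "s < 1" "\<alpha> s * y < ?b"
      by (metis (no_types, lifting) eventually_happens trivial_limit_at_right_real)
    have "(\<lambda>k. \<alpha> s * y + \<beta> s * d k) \<longlonglongrightarrow> \<alpha> s * y + 0"
      by (intro tendsto_add tendsto_const d0)
    then have "(\<lambda>k. \<alpha> s * y + \<beta> s * d k) \<longlonglongrightarrow> \<alpha> s * y" by simp
    from order_tendstoD(2)[OF this s(3)] show "eventually (\<lambda>k. y < ?a k) sequentially"
    proof eventually_elim
      fix k assume "\<alpha> s * y + \<beta> s * d k < ?b"
      also note lo[OF s(1,2), of k]
      finally have "\<alpha> s * y < \<alpha> s * ?a k"
        by (meson add_right_mono leD leI)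
      then show "y < ?a k"
        by (meson leD leI mult_left_mono zero_le)
    qed
  qed
qed

lemma ennreal_tendsto_0_le:
  fixes f g :: "nat \<Rightarrow> ennreal"
  assumes "g \<longlonglongrightarrow> 0" "\<And>k. f k \<le> g k"
  shows "f \<longlonglongrightarrow> 0"
  by (rule tendsto_sandwich[OF _ _ tendsto_const assms(1)]) (simp_all add: assms(2))

lemma AE_subseq_if_nn_integral_tendsto_0:
  fixes f :: "nat \<Rightarrow> 'a \<Rightarrow> real"
  assumes [measurable]: "\<And>k. f k \<in> borel_measurable M"
    and lim: "(\<lambda>k. \<integral>\<^sup>+x. ennreal \<bar>f k x\<bar> \<partial>M) \<longlonglongrightarrow> 0"
  obtains r :: "nat \<Rightarrow> nat" where "filterlim r at_top sequentially" "AE x in M. (\<lambda>i. f (r i) x) \<longlonglongrightarrow> 0"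
proof -
  have "eventually (\<lambda>k. (\<integral>\<^sup>+x. ennreal \<bar>f k x\<bar> \<partial>M) < \<infinity>) sequentially"
    by (rule order_tendstoD(2)[OF lim]) simp
  then obtain k0 where k0: "\<And>k. k0 \<le> k \<Longrightarrow> (\<integral>\<^sup>+x. ennreal \<bar>f k x\<bar> \<partial>M) < \<infinity>"
    by (auto simp: eventually_sequentially)
  have int: "integrable M (f (k + k0))" for k
    using k0[of "k + k0"] by (intro integrableI_bounded) auto
  have "(\<lambda>k. ennreal (\<integral>x. norm (f (k + k0) x) \<partial>M)) \<longlonglongrightarrow> 0"
    using LIMSEQ_ignore_initial_segment[OF lim, of k0] int
    by (subst nn_integral_eq_integral[symmetric]) auto
  then have "(\<lambda>k. \<integral>x. norm (f (k + k0) x) \<partial>M) \<longlonglongrightarrow> 0"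
    by (subst (asm) ennreal_tendsto_0_iff) auto
  from tendsto_L1_AE_subseq[OF int this] obtain r :: "nat \<Rightarrow> nat" where
    r: "strict_mono r" "AE x in M. (\<lambda>i. f (r i + k0) x) \<longlonglongrightarrow> 0" by blast
  have "filterlim (\<lambda>i. r i + k0) at_top sequentially"
    using filterlim_subseq[OF r(1)] by (rule filterlim_at_top_mono) simp
  from that[OF this r(2)] show ?thesis .
qed

section \<open>Test functions on a star-shaped domain\<close>

definition c1_compact :: "(real ^ 'n) set \<Rightarrow> (real ^ 'n \<Rightarrow> real) \<Rightarrow> (real ^ 'n \<Rightarrow> real ^ 'n) \<Rightarrow> bool" where
  "c1_compact \<Omega> v g \<longleftrightarrow> (\<forall>x. GDERIV v x :> g x) \<and> continuous_on UNIV g \<and>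
     (\<exists>K. compact K \<and> K \<subseteq> \<Omega> \<and> (\<forall>x. x \<notin> K \<longrightarrow> v x = 0))"

lemma c1_compact_continuous: "c1_compact \<Omega> v g \<Longrightarrow> continuous_on S v"
  unfolding c1_compact_def gderiv_def
  by (meson continuous_at_imp_continuous_on has_derivative_continuous)

lemma c1_compact_measurable:
  assumes "c1_compact \<Omega> v g"
  shows "v \<in> borel_measurable borel" "g \<in> borel_measurable borel"
  using assms c1_compact_continuous[OF assms]
  by (auto simp: c1_compact_def intro: borel_measurable_continuous_onI)

lemma c1_compact_diff:
  assumes "c1_compact \<Omega> v g" "c1_compact \<Omega> w h"
  shows "c1_compact \<Omega> (\<lambda>x. v x - w x) (\<lambda>x. g x - h x)"
proof -
  obtain K L where "compact K" "K \<subseteq> \<Omega>" "\<forall>x. x \<notin> K \<longrightarrow> v x = 0"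
    "compact L" "L \<subseteq> \<Omega>" "\<forall>x. x \<notin> L \<longrightarrow> w x = 0"
    using assms unfolding c1_compact_def by blast
  then have "\<exists>K. compact K \<and> K \<subseteq> \<Omega> \<and> (\<forall>x. x \<notin> K \<longrightarrow> v x - w x = 0)"
    by (intro exI[of _ "K \<union> L"]) auto
  then show ?thesis
    using assms unfolding c1_compact_def
    by (auto intro!: continuous_intros GDERIV_diff)
qed

lemma c1_compact_ray_derivative:
  assumes "c1_compact \<Omega> v g" and "x \<noteq> 0"
  shows "((\<lambda>r. v ((r / norm x) *\<^sub>R x)) has_real_derivative (x \<bullet> g ((r / norm x) *\<^sub>R x)) / norm x) (at r)"
proof -
  have "((\<lambda>r. (r / norm x) *\<^sub>R x) has_derivative (\<lambda>r. (r / norm x) *\<^sub>R x)) (at r)"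
    using assms(2) by (auto intro!: derivative_eq_intros)
  moreover have "(v has_derivative (\<lambda>h. h \<bullet> g ((r / norm x) *\<^sub>R x))) (at ((r / norm x) *\<^sub>R x))"
    using assms by (simp add: c1_compact_def gderiv_def)
  ultimately have "((\<lambda>r. v ((r / norm x) *\<^sub>R x)) has_derivative
      (\<lambda>s. ((s / norm x) *\<^sub>R x) \<bullet> g ((r / norm x) *\<^sub>R x))) (at r)"
    by (rule has_derivative_compose)
  then show ?thesis
    unfolding has_field_derivative_def by (rule has_derivative_eq_rhs) (auto simp: fun_eq_iff)
qed

lemma test_function_c1_compact:
  assumes "test_function \<Omega> v"
  shows "c1_compact \<Omega> v (gradient v)"
proof -
  have "C_class (Suc 0) v"
    using assms unfolding test_function_def by blast
  then have diff: "v differentiable (at x)" and cont: "continuous_on UNIV (\<lambda>x. gradient v x $ i)" for x i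
    by auto
  have "GDERIV v x :> gradient v x" for x
  proof -
    obtain D where D: "(v has_derivative D) (at x)"
      using diff by (auto simp: differentiable_def)
    then have "linear D" by (rule has_derivative_linear)
    then have "D = (\<lambda>h. h \<bullet> adjoint D 1)"
      by (simp add: adjoint_works)
    then have "GDERIV v x :> adjoint D 1"
      using D by (simp add: gderiv_def)
    moreover have "E = adjoint D 1" if "GDERIV v x :> E" for E
      using has_derivative_unique[OF that[unfolded gderiv_def] calculation[unfolded gderiv_def]]
      by (metis vector_eq_ldot)
    ultimately have "\<exists>!D. GDERIV v x :> D"
      by blast
    then show ?thesis
      unfolding gradient_def by (rule theI')
  qed
  moreover have "continuous_on UNIV (gradient v)"
    using continuous_on_vec_lambda[of UNIV "\<lambda>i x. gradient v x $ i"] cont by simp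
  moreover have "\<exists>K. compact K \<and> K \<subseteq> \<Omega> \<and> (\<forall>x. x \<notin> K \<longrightarrow> v x = 0)"
    using assms closure_subset[of "{x. v x \<noteq> 0}"] unfolding test_function_def by blast
  ultimately show ?thesis
    by (simp add: c1_compact_def)
qed

locale radial_hardy =
  fixes \<Omega> :: "(real ^ 'n) set" and \<phi> :: "real ^ 'n \<Rightarrow> real" and n a p \<delta> :: real
  assumes n: "n = real CARD('n)" "2 \<le> n" and p: "1 < p" and a: "0 < a" "a \<le> 1"
    and \<phi>_pos: "\<And>x. 0 < \<phi> x" and \<phi>_scale: "\<And>t x. 0 < t \<Longrightarrow> \<phi> (t *\<^sub>R x) = \<phi> x"
    and \<Omega>_eq: "\<Omega> = {x. norm x < \<phi> x}" and \<Omega>_open: "open \<Omega>" and \<Omega>_bounded: "bounded \<Omega>"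
    and \<delta>: "0 < \<delta>" "ball 0 \<delta> \<subseteq> \<Omega>"
begin

lemma \<phi>_normalize: "x \<noteq> 0 \<Longrightarrow> 0 < r \<Longrightarrow> \<phi> ((r / norm x) *\<^sub>R x) = \<phi> x"
  by (rule \<phi>_scale) simp

lemma \<delta>_le_\<phi>:
  assumes x: "x \<noteq> 0"
  shows "\<delta> \<le> \<phi> x"
proof (rule dense_le_bounded[of 0])
  fix r assume r: "0 < r" "r < \<delta>"
  then have "(r / norm x) *\<^sub>R x \<in> \<Omega>"
    using \<delta> by (intro subsetD[OF \<delta>(2)]) simp
  then show "r \<le> \<phi> x"
    using x r by (simp add: \<Omega>_eq \<phi>_normalize)
qed (rule \<delta>)

lemma \<phi>_measurable [measurable]: "\<phi> \<in> borel_measurable borel"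
proof (rule borel_measurableI_greater)
  fix c :: real
  have [measurable]: "\<Omega> \<in> sets borel" using \<Omega>_open by simp
  have "c < \<phi> x \<longleftrightarrow> (if x = 0 then c < \<phi> 0 else c \<le> 0 \<or> (c / norm x) *\<^sub>R x \<in> \<Omega>)" for x
    using \<phi>_pos[of x] by (cases "c \<le> 0") (auto simp: \<Omega>_eq \<phi>_normalize)
  then have "{x \<in> space borel. c < \<phi> x}
    = {x \<in> space borel. if x = 0 then c < \<phi> 0 else c \<le> 0 \<or> (c / norm x) *\<^sub>R x \<in> \<Omega>}"
    by simp
  also have "\<dots> \<in> sets borel" by measurable
  finally show "{x \<in> space borel. c < \<phi> x} \<in> sets borel" .
qed

lemma support_gap:
  assumes "c1_compact \<Omega> v g"
  obtains \<eta> where "0 < \<eta>" "\<And>x. v x \<noteq> 0 \<Longrightarrow> (1 + \<eta>) * norm x < \<phi> x"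
proof -
  obtain K where K: "compact K" "K \<subseteq> \<Omega>" "\<forall>x. x \<notin> K \<longrightarrow> v x = 0"
    using assms unfolding c1_compact_def by blast
  obtain e where e: "0 < e" "(\<Union>x\<in>K. ball x e) \<subseteq> \<Omega>"
    using compact_subset_open_imp_ball_epsilon_subset[OF K(1) \<Omega>_open K(2)] by blast
  obtain M where M: "0 < M" "\<forall>x\<in>K. norm x \<le> M"
    using compact_imp_bounded[OF K(1)] by (auto simp: bounded_pos)
  define \<eta> where "\<eta> = e / (2 * M)"
  have \<eta>: "0 < \<eta>" using e M by (simp add: \<eta>_def)
  show ?thesis
  proof (rule that[OF \<eta>])
    fix x assume "v x \<noteq> 0"
    then have x: "x \<in> K" using K(3) by blast
    have "\<eta> * norm x \<le> \<eta> * M"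
      using M x \<eta> by (intro mult_left_mono) auto
    also have "\<dots> < e" using e M by (simp add: \<eta>_def)
    finally have "dist x ((1 + \<eta>) *\<^sub>R x) < e"
      using \<eta> by (simp add: dist_norm algebra_simps)
    then have "(1 + \<eta>) *\<^sub>R x \<in> ball x e" by simp
    then have "(1 + \<eta>) *\<^sub>R x \<in> \<Omega>" using e(2) x by blast
    then show "(1 + \<eta>) * norm x < \<phi> x"
      using \<eta> by (simp add: \<Omega>_eq \<phi>_scale)
  qed
qed

definition hardy_weight :: "real ^ 'n \<Rightarrow> real" where
  "hardy_weight x = 1 / (norm x powr (n - a) * \<bar>\<phi> x powr a - norm x powr a\<bar> powr p)"

definition radial_weight :: "real ^ 'n \<Rightarrow> real" where
  "radial_weight x = norm x powr ((1 - a) * (p - 1) + 1 - n)"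

definition annulus_weight :: "real \<Rightarrow> real ^ 'n \<Rightarrow> real" where
  "annulus_weight \<epsilon> x = (if \<epsilon> \<le> norm x then hardy_weight x else 0)"

definition hardy_annulus :: "real \<Rightarrow> (real ^ 'n \<Rightarrow> real) \<Rightarrow> ennreal" where
  "hardy_annulus \<epsilon> u = (\<integral>\<^sup>+x. ennreal (annulus_weight \<epsilon> x * \<bar>u x\<bar> powr p) \<partial>lebesgue_on \<Omega>)"

definition radial_energy :: "(real ^ 'n \<Rightarrow> real ^ 'n) \<Rightarrow> ennreal" where
  "radial_energy G = (\<integral>\<^sup>+x. ennreal (radial_weight x * \<bar>(x \<bullet> G x) / norm x\<bar> powr p) \<partial>lebesgue_on \<Omega>)"

definition sphere_term :: "real \<Rightarrow> (real ^ 'n \<Rightarrow> real) \<Rightarrow> ennreal" where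
  "sphere_term \<epsilon> T = ennreal (\<epsilon> powr (1 - n)) *
     (\<integral>\<^sup>+x. ennreal (\<bar>T x\<bar> powr p / \<phi> x powr (a * (p - 1))) \<partial>sphere_measure \<epsilon>)"

lemma weight_measurable [measurable]:
  "hardy_weight \<in> borel_measurable borel"
  "radial_weight \<in> borel_measurable borel"
  "annulus_weight \<epsilon> \<in> borel_measurable borel"
  unfolding hardy_weight_def[abs_def] radial_weight_def[abs_def] annulus_weight_def[abs_def]
  by measurable

lemma weight_nonneg: "0 \<le> hardy_weight x" "0 \<le> radial_weight x" "0 \<le> annulus_weight \<epsilon> x"
  by (auto simp: hardy_weight_def radial_weight_def annulus_weight_def)

lemma nn_integral_lebesgue_on:
  "(\<integral>\<^sup>+x. f x \<partial>lebesgue_on \<Omega>) = (\<integral>\<^sup>+x. f x * indicator \<Omega> x \<partial>lborel)"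
  using \<Omega>_open by (subst nn_integral_restrict_space) (auto simp: nn_integral_completion)

lemma borel_measurable_lebesgue_on [measurable (raw)]:
  "f \<in> borel_measurable borel \<Longrightarrow> f \<in> borel_measurable (lebesgue_on \<Omega>)"
  by (intro measurable_restrict_space1 measurable_completion) simp

lemma hardy_young_test:
  assumes v: "c1_compact \<Omega> v g" and \<epsilon>: "0 < \<epsilon>" "\<epsilon> < \<delta>" and \<mu>: "0 < \<mu>"
  shows "ennreal (a * (p - 1)) * hardy_annulus \<epsilon> v + sphere_term \<epsilon> v
    \<le> ennreal (\<mu> powr (1 - p)) * radial_energy g + ennreal ((p - 1) * \<mu>) * hardy_annulus \<epsilon> v"
proof -
  let ?N = "CARD('n)"
  note [measurable] = c1_compact_measurable[OF v]
  have [measurable]: "\<Omega> \<in> sets borel" using \<Omega>_open by simp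
  have [measurable]: "ball (0 :: real ^ 'n) s \<in> sets borel" for s by simp
  define F1 where "F1 x = ennreal (a * (p - 1) * (annulus_weight \<epsilon> x * \<bar>v x\<bar> powr p)) * indicator \<Omega> x" for x
  define F2 where "F2 x = ennreal (\<mu> powr (1 - p) * (if \<epsilon> \<le> norm x then radial_weight x * \<bar>(x \<bullet> g x) / norm x\<bar> powr p else 0)
     + (p - 1) * \<mu> * (annulus_weight \<epsilon> x * \<bar>v x\<bar> powr p)) * indicator \<Omega> x" for x
  define j where "j x = ennreal (\<bar>v ((\<epsilon> / norm x) *\<^sub>R x)\<bar> powr p / \<phi> ((\<epsilon> / norm x) *\<^sub>R x) powr (a * (p - 1)))" for x
  have [measurable]: "F1 \<in> borel_measurable borel" "F2 \<in> borel_measurable borel" "j \<in> borel_measurable borel"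
    unfolding F1_def[abs_def] F2_def[abs_def] j_def[abs_def] by measurable
  obtain \<eta> where \<eta>: "0 < \<eta>" "\<And>x. v x \<noteq> 0 \<Longrightarrow> (1 + \<eta>) * norm x < \<phi> x"
    using support_gap[OF v] by blast
  have ray: "(\<integral>\<^sup>+r. F1 ((r / norm x) *\<^sub>R x) * ennreal (r ^ (?N - 1)) * indicator {0<..} r \<partial>lborel) + j x
     \<le> (\<integral>\<^sup>+r. F2 ((r / norm x) *\<^sub>R x) * ennreal (r ^ (?N - 1)) * indicator {0<..} r \<partial>lborel)"
    if x: "x \<noteq> 0" for x
  proof -
    define R where "R = \<phi> x"
    define h where "h r = v ((r / norm x) *\<^sub>R x)" for r
    define h' where "h' r = (x \<bullet> g ((r / norm x) *\<^sub>R x)) / norm x" for r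
    define k where "k r = \<bar>h r\<bar> powr p * r powr (a - 1) / (R powr a - r powr a) powr p" for r
    define R0 where "R0 = max (R / (1 + \<eta>)) ((\<epsilon> + R) / 2)"
    have \<epsilon>R: "\<epsilon> < R" "0 < R"
      using \<delta>_le_\<phi>[OF x] \<epsilon> by (auto simp: R_def)
    have R0: "\<epsilon> < R0" "R0 < R"
      using \<epsilon>R \<eta> by (auto simp: R0_def field_simps less_max_iff_disj)
    have h0: "h r = 0" if r: "R0 \<le> r" "r < R" for r
    proof (rule ccontr)
      assume "h r \<noteq> 0"
      then have "(1 + \<eta>) * r < R"
        using \<eta>(2)[of "(r / norm x) *\<^sub>R x"] x r R0 \<epsilon> by (simp add: h_def R_def \<phi>_normalize)
      moreover have "R / (1 + \<eta>) \<le> r" using r by (simp add: R0_def)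
      ultimately show False using \<eta>(1) by (simp add: field_simps)
    qed
    have h'_cont: "continuous_on UNIV h'"
    proof -
      have "continuous_on UNIV (\<lambda>r::real. (r / norm x) *\<^sub>R x)"
        by (intro continuous_on_scaleR continuous_on_divide continuous_on_id continuous_on_const) (use x in auto)
      then have "continuous_on UNIV (\<lambda>r. g ((r / norm x) *\<^sub>R x))"
        using v continuous_on_compose2[of UNIV g UNIV] unfolding c1_compact_def by blast
      then show ?thesis
        unfolding h'_def[abs_def]
        by (intro continuous_on_divide continuous_on_inner continuous_on_const) (use x in auto)
    qed
    have in_\<Omega>: "(r / norm x) *\<^sub>R x \<in> \<Omega> \<longleftrightarrow> r < R" if "0 < r" for r
      using that x by (simp add: \<Omega>_eq R_def \<phi>_normalize)
    have rpow: "ennreal (r ^ (?N - 1)) = ennreal (r powr (n - 1))" if "0 < r" for r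
      using that n by (simp add: powr_realpow[symmetric] of_nat_diff)
    have hw: "hardy_weight ((r / norm x) *\<^sub>R x) * \<bar>h r\<bar> powr p * r powr (n - 1) = k r" if "0 < r" "r < R" for r
    proof -
      have "r powr a < R powr a" using that a by (simp add: powr_less_mono2)
      moreover have "r powr (n - 1) = r powr (a - 1) * r powr (n - a)"
        by (simp add: powr_add[symmetric])
      ultimately show ?thesis
        using that x by (simp add: hardy_weight_def k_def \<phi>_normalize R_def[symmetric])
    qed
    have rw: "radial_weight ((r / norm x) *\<^sub>R x) * b * r powr (n - 1) = r powr ((1 - a) * (p - 1)) * b"
      if "0 < r" for r b
    proof -
      have "r powr ((1 - a) * (p - 1) + 1 - n) * r powr (n - 1) = r powr ((1 - a) * (p - 1))"
        using that by (simp add: powr_add[symmetric])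
      then show ?thesis
        using that x by (simp add: radial_weight_def mult_ac)
    qed
    have rad: "((r / norm x) *\<^sub>R x) \<bullet> g ((r / norm x) *\<^sub>R x) / norm ((r / norm x) *\<^sub>R x) = h' r" if "0 < r" for r
      using that x by (simp add: h'_def)
    have E1: "F1 ((r / norm x) *\<^sub>R x) * ennreal (r ^ (?N - 1)) * indicator {0<..} r
      = ennreal (a * (p - 1) * k r) * indicator {\<epsilon>..<R} r" for r
    proof (cases "r \<in> {\<epsilon>..<R}")
      case True
      then have r: "0 < r" "r < R" "\<epsilon> \<le> r" using \<epsilon> by auto
      have "F1 ((r / norm x) *\<^sub>R x) * ennreal (r ^ (?N - 1)) * indicator {0<..} r
        = ennreal (a * (p - 1) * (hardy_weight ((r / norm x) *\<^sub>R x) * \<bar>h r\<bar> powr p)) * ennreal (r powr (n - 1))"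
        using r x by (simp add: F1_def annulus_weight_def in_\<Omega> rpow[OF r(1), unfolded One_nat_def] h_def)
      also have "\<dots> = ennreal (a * (p - 1) * (hardy_weight ((r / norm x) *\<^sub>R x) * \<bar>h r\<bar> powr p * r powr (n - 1)))"
        by (subst ennreal_mult''[symmetric]) (auto simp: mult_ac)
      finally show ?thesis using True r by (simp add: hw)
    next
      case False
      then show ?thesis using \<epsilon> x by (auto simp: F1_def annulus_weight_def in_\<Omega> indicator_def)
    qed
    have E2: "F2 ((r / norm x) *\<^sub>R x) * ennreal (r ^ (?N - 1)) * indicator {0<..} r
      = ennreal (\<mu> powr (1 - p) * (r powr ((1 - a) * (p - 1)) * \<bar>h' r\<bar> powr p)
          + (p - 1) * \<mu> * k r) * indicator {\<epsilon>..<R} r" for r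
    proof (cases "r \<in> {\<epsilon>..<R}")
      case True
      then have r: "0 < r" "r < R" "\<epsilon> \<le> r" using \<epsilon> by auto
      have "F2 ((r / norm x) *\<^sub>R x) * ennreal (r ^ (?N - 1)) * indicator {0<..} r
        = ennreal (\<mu> powr (1 - p) * (radial_weight ((r / norm x) *\<^sub>R x) * \<bar>h' r\<bar> powr p)
           + (p - 1) * \<mu> * (hardy_weight ((r / norm x) *\<^sub>R x) * \<bar>h r\<bar> powr p)) * ennreal (r powr (n - 1))"
        using r x rad[OF r(1)] by (simp add: F2_def annulus_weight_def in_\<Omega> rpow[OF r(1), unfolded One_nat_def] h_def)
      also have "\<dots> = ennreal (\<mu> powr (1 - p) * (radial_weight ((r / norm x) *\<^sub>R x) * \<bar>h' r\<bar> powr p * r powr (n - 1))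
           + (p - 1) * \<mu> * (hardy_weight ((r / norm x) *\<^sub>R x) * \<bar>h r\<bar> powr p * r powr (n - 1)))"
        by (subst ennreal_mult''[symmetric]) (auto simp: algebra_simps)
      finally show ?thesis using True r by (simp add: hw rw)
    next
      case False
      then show ?thesis using \<epsilon> x by (auto simp: F2_def annulus_weight_def in_\<Omega> indicator_def)
    qed
    have "j x \<le> ennreal (\<bar>h \<epsilon>\<bar> powr p * (R powr a - \<epsilon> powr a) powr (1 - p))"
    proof -
      have "0 < R powr a - \<epsilon> powr a" using \<epsilon>R \<epsilon> a by (simp add: powr_less_mono2)
      then have "(R powr a) powr (1 - p) \<le> (R powr a - \<epsilon> powr a) powr (1 - p)"
        using p by (intro powr_mono2') auto
      moreover have "(R powr a) powr (1 - p) = 1 / R powr (a * (p - 1))"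
        using powr_minus_divide[of R "a * (p - 1)"] by (simp add: powr_powr algebra_simps)
      ultimately have "\<bar>h \<epsilon>\<bar> powr p * (1 / R powr (a * (p - 1))) \<le> \<bar>h \<epsilon>\<bar> powr p * (R powr a - \<epsilon> powr a) powr (1 - p)"
        by (intro mult_left_mono) auto
      then show ?thesis
        using x \<epsilon> unfolding j_def by (intro ennreal_leI) (simp add: h_def R_def \<phi>_normalize)
    qed
    with hardy_on_ray[OF a(1) p \<mu> \<epsilon>(1) R0(1,2) c1_compact_ray_derivative[OF v x, folded h_def h'_def] h'_cont h0]
    show ?thesis
      unfolding E1 E2 k_def by (meson add_left_mono order_trans)
  qed
  have "(\<integral>\<^sup>+x. F1 x \<partial>lborel) + sphere_term \<epsilon> v \<le> (\<integral>\<^sup>+x. F2 x \<partial>lborel)"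
  proof -
    define I where "I F x = (\<integral>\<^sup>+r. F ((r / norm x) *\<^sub>R x) * ennreal (r ^ (?N - 1)) * indicator {0<..} r \<partial>lborel)"
      for F :: "real ^ 'n \<Rightarrow> ennreal" and x
    have [measurable]: "I F1 \<in> borel_measurable borel"
      unfolding I_def[abs_def] by measurable
    have polar: "(\<integral>\<^sup>+x. F x \<partial>lborel) = ennreal n * (\<integral>\<^sup>+x. I F x * indicator (ball 0 1) x \<partial>lborel)"
      if "F \<in> borel_measurable borel" for F
      using nn_integral_polar[OF that] by (simp add: n(1) I_def)
    have J: "sphere_term \<epsilon> v = ennreal n * (\<integral>\<^sup>+x. j x * indicator (ball 0 1) x \<partial>lborel)"
      unfolding sphere_term_def j_def using \<epsilon>
      by (subst nn_integral_sphere_measure[where 'n = 'n, folded n(1)]) auto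
    have "(\<integral>\<^sup>+x. F1 x \<partial>lborel) + sphere_term \<epsilon> v
      = ennreal n * ((\<integral>\<^sup>+x. I F1 x * indicator (ball 0 1) x \<partial>lborel) + (\<integral>\<^sup>+x. j x * indicator (ball 0 1) x \<partial>lborel))"
      by (simp only: J polar[OF \<open>F1 \<in> _\<close>] distrib_left)
    also have "\<dots> = ennreal n * (\<integral>\<^sup>+x. (I F1 x + j x) * indicator (ball 0 1) x \<partial>lborel)"
      by (subst nn_integral_add[symmetric]) (auto simp: distrib_right)
    also have "\<dots> \<le> ennreal n * (\<integral>\<^sup>+x. I F2 x * indicator (ball 0 1) x \<partial>lborel)"
    proof (intro mult_left_mono nn_integral_mono_AE)
      show "AE x in lborel. (I F1 x + j x) * indicator (ball 0 1) x \<le> I F2 x * indicator (ball 0 1) x"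
        using AE_lborel_singleton[of "0 :: real ^ 'n"]
        by eventually_elim (unfold I_def, intro mult_right_mono ray, auto)
    qed auto
    also have "\<dots> = (\<integral>\<^sup>+x. F2 x \<partial>lborel)"
      by (rule polar[OF \<open>F2 \<in> _\<close>, symmetric])
    finally show ?thesis .
  qed
  moreover have "(\<integral>\<^sup>+x. F1 x \<partial>lborel) = ennreal (a * (p - 1)) * hardy_annulus \<epsilon> v"
    unfolding hardy_annulus_def F1_def nn_integral_lebesgue_on[symmetric]
    using a p weight_nonneg by (subst nn_integral_cmult[symmetric]) (auto simp: ennreal_mult')
  moreover have "(\<integral>\<^sup>+x. F2 x \<partial>lborel) \<le> ennreal (\<mu> powr (1 - p)) * radial_energy g + ennreal ((p - 1) * \<mu>) * hardy_annulus \<epsilon> v"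
  proof -
    have "(\<integral>\<^sup>+x. F2 x \<partial>lborel) \<le> (\<integral>\<^sup>+x. ennreal (\<mu> powr (1 - p)) * ennreal (radial_weight x * \<bar>(x \<bullet> g x) / norm x\<bar> powr p)
       + ennreal ((p - 1) * \<mu>) * ennreal (annulus_weight \<epsilon> x * \<bar>v x\<bar> powr p) \<partial>lebesgue_on \<Omega>)"
      unfolding F2_def nn_integral_lebesgue_on[symmetric]
    proof (rule nn_integral_mono)
      fix x
      have "\<mu> powr (1 - p) * (if \<epsilon> \<le> norm x then radial_weight x * \<bar>(x \<bullet> g x) / norm x\<bar> powr p else 0)
         \<le> \<mu> powr (1 - p) * (radial_weight x * \<bar>(x \<bullet> g x) / norm x\<bar> powr p)"
        using weight_nonneg(2)[of x] by (intro mult_left_mono) auto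
      then have "ennreal (\<mu> powr (1 - p) * (if \<epsilon> \<le> norm x then radial_weight x * \<bar>(x \<bullet> g x) / norm x\<bar> powr p else 0)
         + (p - 1) * \<mu> * (annulus_weight \<epsilon> x * \<bar>v x\<bar> powr p))
        \<le> ennreal (\<mu> powr (1 - p) * (radial_weight x * \<bar>(x \<bullet> g x) / norm x\<bar> powr p)
         + (p - 1) * \<mu> * (annulus_weight \<epsilon> x * \<bar>v x\<bar> powr p))"
        by (intro ennreal_leI) simp
      also have "\<dots> = ennreal (\<mu> powr (1 - p)) * ennreal (radial_weight x * \<bar>(x \<bullet> g x) / norm x\<bar> powr p)
       + ennreal ((p - 1) * \<mu>) * ennreal (annulus_weight \<epsilon> x * \<bar>v x\<bar> powr p)"
        using weight_nonneg(2)[of x] weight_nonneg(3)[of \<epsilon> x] p \<mu>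
        by (subst ennreal_plus) (auto simp: ennreal_mult)
      finally show "ennreal (\<mu> powr (1 - p) * (if \<epsilon> \<le> norm x then radial_weight x * \<bar>(x \<bullet> g x) / norm x\<bar> powr p else 0)
         + (p - 1) * \<mu> * (annulus_weight \<epsilon> x * \<bar>v x\<bar> powr p)) \<le> \<dots>" .
    qed
    also have "\<dots> = ennreal (\<mu> powr (1 - p)) * radial_energy g + ennreal ((p - 1) * \<mu>) * hardy_annulus \<epsilon> v"
      unfolding radial_energy_def hardy_annulus_def
      by (subst nn_integral_add, measurable) (simp add: nn_integral_cmult)
    finally show ?thesis .
  qed
  ultimately show ?thesis by (metis order_trans)
qed

lemma emeasure_\<Omega>_finite: "emeasure lborel \<Omega> < \<infinity>"
  using \<Omega>_bounded \<Omega>_open by (intro emeasure_bounded_finite)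

lemma radial_weight_integral_finite: "(\<integral>\<^sup>+x. ennreal (radial_weight x) \<partial>lebesgue_on \<Omega>) < \<infinity>"
proof -
  let ?N = "CARD('n)"
  have [measurable]: "\<Omega> \<in> sets borel" using \<Omega>_open by simp
  obtain M where M: "0 < M" "\<And>x. x \<in> \<Omega> \<Longrightarrow> norm x \<le> M"
    using \<Omega>_bounded by (auto simp: bounded_pos)
  define e where "e = (1 - a) * (p - 1)"
  have e: "0 \<le> e" using a p by (simp add: e_def)
  define F where "F x = ennreal (radial_weight x) * indicator \<Omega> x" for x
  have [measurable]: "F \<in> borel_measurable borel"
    unfolding F_def[abs_def] by measurable
  define I where "I x = (\<integral>\<^sup>+r. F ((r / norm x) *\<^sub>R x) * ennreal (r ^ (?N - 1)) * indicator {0<..} r \<partial>lborel)" for x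
  have I_le: "I x \<le> ennreal (M powr e * M)" if x: "x \<noteq> 0" for x
  proof -
    have "I x \<le> (\<integral>\<^sup>+r. ennreal (M powr e) * indicator {0..M} r \<partial>lborel)"
      unfolding I_def
    proof (rule nn_integral_mono)
      fix r :: real
      show "F ((r / norm x) *\<^sub>R x) * ennreal (r ^ (?N - 1)) * indicator {0<..} r \<le> ennreal (M powr e) * indicator {0..M} r"
      proof (cases "0 < r \<and> (r / norm x) *\<^sub>R x \<in> \<Omega>")
        case True
        then have r: "0 < r" "r \<le> M" using M(2)[of "(r / norm x) *\<^sub>R x"] x by auto
        have "radial_weight ((r / norm x) *\<^sub>R x) = r powr (e + 1 - n)"
          using r x by (simp add: radial_weight_def e_def)
        moreover have "r ^ (?N - 1) = r powr (n - 1)"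
          using r n by (simp add: powr_realpow[symmetric] of_nat_diff)
        ultimately have "ennreal (radial_weight ((r / norm x) *\<^sub>R x)) * ennreal (r ^ (?N - 1)) = ennreal (r powr (e + 1 - n) * r powr (n - 1))"
          by (simp add: ennreal_mult''[symmetric])
        also have "r powr (e + 1 - n) * r powr (n - 1) = r powr e"
          by (simp add: powr_add[symmetric])
        also have "ennreal (r powr e) \<le> ennreal (M powr e)"
          using r e by (intro ennreal_leI powr_mono2) auto
        finally show ?thesis using True r by (simp add: F_def)
      qed (auto simp: F_def)
    qed
    also have "\<dots> = ennreal (M powr e * M)"
      using M by (subst nn_integral_cmult) (auto simp: ennreal_mult)
    finally show ?thesis .
  qed
  have "(\<integral>\<^sup>+x. ennreal (radial_weight x) \<partial>lebesgue_on \<Omega>) = ennreal n * (\<integral>\<^sup>+x. I x * indicator (ball 0 1) x \<partial>lborel)"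
    using nn_integral_polar[of F] by (simp add: nn_integral_lebesgue_on F_def I_def n(1))
  also have "\<dots> \<le> ennreal n * (\<integral>\<^sup>+x. ennreal (M powr e * M) * indicator (ball (0 :: real ^ 'n) 1) x \<partial>lborel)"
  proof (intro mult_left_mono nn_integral_mono_AE)
    show "AE x in lborel. I x * indicator (ball 0 1) x \<le> ennreal (M powr e * M) * indicator (ball 0 1) x"
      using AE_lborel_singleton[of "0 :: real ^ 'n"]
      by eventually_elim (intro mult_right_mono I_le, auto)
  qed auto
  also have "\<dots> = ennreal n * (ennreal (M powr e * M) * emeasure lborel (ball (0 :: real ^ 'n) 1))"
    by (subst nn_integral_cmult_indicator) auto
  also have "\<dots> < \<infinity>"
    using emeasure_bounded_finite[OF bounded_ball, of "0 :: real ^ 'n" 1]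
    by (simp add: ennreal_mult_less_top)
  finally show ?thesis .
qed

lemma gradient_energy_finite:
  assumes v: "c1_compact \<Omega> v g"
  shows "(\<integral>\<^sup>+x. ennreal (radial_weight x * norm (g x) powr p) \<partial>lebesgue_on \<Omega>) < \<infinity>"
proof -
  have "continuous_on (closure \<Omega>) g"
    using v unfolding c1_compact_def by (auto intro: continuous_on_subset)
  then have "bounded (g ` closure \<Omega>)"
    using \<Omega>_bounded by (intro compact_imp_bounded compact_continuous_image) (auto simp: compact_closure)
  then obtain B where B: "0 < B" "\<And>x. x \<in> \<Omega> \<Longrightarrow> norm (g x) \<le> B"
    using closure_subset[of \<Omega>] by (auto simp: bounded_pos)
  have "(\<integral>\<^sup>+x. ennreal (radial_weight x * norm (g x) powr p) \<partial>lebesgue_on \<Omega>)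
    \<le> (\<integral>\<^sup>+x. ennreal (B powr p) * ennreal (radial_weight x) \<partial>lebesgue_on \<Omega>)"
  proof (rule nn_integral_mono)
    fix x assume "x \<in> space (lebesgue_on \<Omega>)"
    then have "norm (g x) powr p \<le> B powr p"
      using B p by (intro powr_mono2) auto
    then have "radial_weight x * norm (g x) powr p \<le> B powr p * radial_weight x"
      using weight_nonneg(2)[of x] by (subst mult.commute) (rule mult_right_mono)
    then show "ennreal (radial_weight x * norm (g x) powr p) \<le> ennreal (B powr p) * ennreal (radial_weight x)"
      using weight_nonneg(2)[of x] by (simp add: ennreal_mult[symmetric] ennreal_leI)
  qed
  also have "\<dots> = ennreal (B powr p) * (\<integral>\<^sup>+x. ennreal (radial_weight x) \<partial>lebesgue_on \<Omega>)"
    by (rule nn_integral_cmult) measurable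
  also have "\<dots> < \<infinity>"
    using radial_weight_integral_finite by (simp add: ennreal_mult_less_top)
  finally show ?thesis .
qed

lemma radial_component_le: "\<bar>(x \<bullet> y) / norm x\<bar> \<le> norm y"
  using Cauchy_Schwarz_ineq2[of x y] by (cases "x = 0") (auto simp: field_simps)

lemma radial_energy_le:
  "radial_energy G \<le> (\<integral>\<^sup>+x. ennreal (radial_weight x * norm (G x) powr p) \<partial>lebesgue_on \<Omega>)"
  unfolding radial_energy_def using p
  by (intro nn_integral_mono ennreal_leI mult_left_mono powr_mono2 radial_component_le weight_nonneg) auto

lemma hardy_annulus_finite:
  assumes v: "c1_compact \<Omega> v g" and \<epsilon>: "0 < \<epsilon>"
  shows "hardy_annulus \<epsilon> v < \<infinity>"
proof -
  obtain \<eta> where \<eta>: "0 < \<eta>" "\<And>x. v x \<noteq> 0 \<Longrightarrow> (1 + \<eta>) * norm x < \<phi> x"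
    using support_gap[OF v] by blast
  have "bounded (v ` closure \<Omega>)"
    using \<Omega>_bounded c1_compact_continuous[OF v]
    by (intro compact_imp_bounded compact_continuous_image) (auto simp: compact_closure)
  then obtain B where B: "0 < B" "\<And>x. x \<in> \<Omega> \<Longrightarrow> \<bar>v x\<bar> \<le> B"
    using closure_subset[of \<Omega>] by (auto simp: bounded_pos)
  define c where "c = (1 + \<eta>) powr a * \<epsilon> powr a - \<epsilon> powr a"
  have c: "0 < c"
    using powr_less_mono2[of a 1 "1 + \<eta>"] \<eta> a \<epsilon> by (simp add: c_def)
  define C where "C = 1 / (\<epsilon> powr (n - a) * c powr p) * B powr p"
  have le: "annulus_weight \<epsilon> x * \<bar>v x\<bar> powr p \<le> C" if x: "x \<in> \<Omega>" for x
  proof (cases "\<epsilon> \<le> norm x \<and> v x \<noteq> 0")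
    case True
    have "((1 + \<eta>) * norm x) powr a \<le> \<phi> x powr a"
      using \<eta>(2)[of x] \<eta>(1) True a by (intro powr_mono2) auto
    then have "(1 + \<eta>) powr a * norm x powr a - norm x powr a \<le> \<phi> x powr a - norm x powr a"
      using \<eta>(1) by (simp add: powr_mult)
    moreover have "((1 + \<eta>) powr a - 1) * \<epsilon> powr a \<le> ((1 + \<eta>) powr a - 1) * norm x powr a"
      using True \<epsilon> \<eta>(1) a ge_one_powr_ge_zero[of "1 + \<eta>" a] by (intro mult_left_mono powr_mono2) auto
    ultimately have "c \<le> \<phi> x powr a - norm x powr a"
      unfolding c_def by (simp add: algebra_simps)
    then have "c powr p \<le> \<bar>\<phi> x powr a - norm x powr a\<bar> powr p"
      using c p by (intro powr_mono2) auto
    moreover have "\<epsilon> powr (n - a) \<le> norm x powr (n - a)"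
      using True \<epsilon> n a by (intro powr_mono2) auto
    ultimately have "\<epsilon> powr (n - a) * c powr p \<le> norm x powr (n - a) * \<bar>\<phi> x powr a - norm x powr a\<bar> powr p"
      by (intro mult_mono) auto
    moreover have "0 < \<epsilon> powr (n - a) * c powr p"
      using c \<epsilon> by simp
    ultimately have "hardy_weight x \<le> 1 / (\<epsilon> powr (n - a) * c powr p)"
      unfolding hardy_weight_def by (intro frac_le) auto
    then have "annulus_weight \<epsilon> x \<le> 1 / (\<epsilon> powr (n - a) * c powr p)"
      using True by (simp add: annulus_weight_def)
    moreover have "\<bar>v x\<bar> powr p \<le> B powr p"
      using B(2)[OF x] p by (intro powr_mono2) auto
    ultimately show ?thesis
      unfolding C_def by (intro mult_mono) auto
  next
    case False
    then show ?thesis by (auto simp: annulus_weight_def C_def)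
  qed
  have "hardy_annulus \<epsilon> v \<le> (\<integral>\<^sup>+x. ennreal C \<partial>lebesgue_on \<Omega>)"
    unfolding hardy_annulus_def by (intro nn_integral_mono ennreal_leI le) simp
  also have "\<dots> = ennreal C * emeasure lborel \<Omega>"
    unfolding nn_integral_lebesgue_on using \<Omega>_open by (intro nn_integral_cmult_indicator) simp
  also have "\<dots> < \<infinity>"
    using emeasure_\<Omega>_finite by (simp add: ennreal_mult_less_top)
  finally show ?thesis .
qed

definition hardy_constant :: real where
  "hardy_constant = (a / 2) powr (1 - p) / ((p - 1) * (a / 2))"

lemma hardy_annulus_le:
  assumes v: "c1_compact \<Omega> v g" and \<epsilon>: "0 < \<epsilon>" "\<epsilon> < \<delta>"
  shows "hardy_annulus \<epsilon> v \<le> ennreal hardy_constant * radial_energy g"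
proof -
  define K where "K = enn2real (hardy_annulus \<epsilon> v)"
  define E where "E = enn2real (radial_energy g)"
  have K: "hardy_annulus \<epsilon> v = ennreal K" "0 \<le> K"
    using hardy_annulus_finite[OF v \<epsilon>(1)] by (auto simp: K_def)
  have E: "radial_energy g = ennreal E" "0 \<le> E"
    using le_less_trans[OF radial_energy_le gradient_energy_finite[OF v]] by (auto simp: E_def)
  have "ennreal (a * (p - 1)) * hardy_annulus \<epsilon> v
      \<le> ennreal ((a / 2) powr (1 - p)) * radial_energy g + ennreal ((p - 1) * (a / 2)) * hardy_annulus \<epsilon> v"
    using hardy_young_test[OF v \<epsilon>, of "a / 2"] a
    by (auto intro: order_trans[rotated])
  then have "a * (p - 1) * K \<le> (a / 2) powr (1 - p) * E + (p - 1) * (a / 2) * K"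
    using K E a p by (simp add: ennreal_mult[symmetric] ennreal_plus[symmetric] del: ennreal_plus)
  then have "(p - 1) * (a / 2) * K \<le> (a / 2) powr (1 - p) * E"
  proof -
    have "(p - 1) * (a / 2) * K = a * (p - 1) * K / 2" by simp
    with \<open>a * (p - 1) * K \<le> _\<close> show ?thesis by linarith
  qed
  then have "K \<le> hardy_constant * E"
    using a p by (simp add: hardy_constant_def field_simps)
  then show ?thesis
    using K E a p by (simp add: ennreal_mult[symmetric] hardy_constant_def ennreal_leI)
qed

section \<open>Passage to the limit\<close>

definition hardy_energy :: "(real ^ 'n \<Rightarrow> real) \<Rightarrow> ennreal" where
  "hardy_energy u = (\<integral>\<^sup>+x. ennreal (hardy_weight x * \<bar>u x\<bar> powr p) \<partial>lebesgue_on \<Omega>)"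

definition limit_of_tests ::
    "(nat \<Rightarrow> real ^ 'n \<Rightarrow> real) \<Rightarrow> (nat \<Rightarrow> real ^ 'n \<Rightarrow> real ^ 'n) \<Rightarrow> (real ^ 'n \<Rightarrow> real) \<Rightarrow> (real ^ 'n \<Rightarrow> real ^ 'n) \<Rightarrow> bool" where
  "limit_of_tests v g u G \<longleftrightarrow> (\<forall>k. c1_compact \<Omega> (v k) (g k)) \<and>
     u \<in> borel_measurable (lebesgue_on \<Omega>) \<and> G \<in> borel_measurable (lebesgue_on \<Omega>) \<and>
     (\<lambda>k. \<integral>\<^sup>+x. ennreal \<bar>v k x - u x\<bar> \<partial>lebesgue_on \<Omega>) \<longlonglongrightarrow> 0 \<and>
     (\<lambda>k. \<integral>\<^sup>+x. ennreal (radial_weight x * norm (g k x - G x) powr p) \<partial>lebesgue_on \<Omega>) \<longlonglongrightarrow> 0"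

lemma measurable_radial_component [measurable]:
  assumes [measurable]: "G \<in> borel_measurable (lebesgue_on \<Omega>)"
  shows "(\<lambda>x. (x \<bullet> G x) / norm x) \<in> borel_measurable (lebesgue_on \<Omega>)"
proof -
  have [measurable]: "(\<lambda>x. x) \<in> borel_measurable (lebesgue_on \<Omega>)"
    by (rule borel_measurable_lebesgue_on) simp
  show ?thesis by measurable
qed

lemma radial_energy_diff_le:
  assumes [measurable]: "F \<in> borel_measurable (lebesgue_on \<Omega>)" "G \<in> borel_measurable (lebesgue_on \<Omega>)"
  shows "radial_energy (\<lambda>x. F x - G x) \<le> ennreal ((1 / 2) powr (1 - p)) * radial_energy F + ennreal ((1 / 2) powr (1 - p)) * radial_energy G"
  using nn_integral_weighted_add_powr_le[of radial_weight "lebesgue_on \<Omega>"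
      "\<lambda>x. (x \<bullet> F x) / norm x" "\<lambda>x. - ((x \<bullet> G x) / norm x)" p "1 / 2"] p weight_nonneg
  by (simp add: radial_energy_def inner_diff_right diff_divide_distrib borel_measurable_lebesgue_on)

lemma limit_of_testsD:
  assumes "limit_of_tests v g u G"
  shows "c1_compact \<Omega> (v k) (g k)" "u \<in> borel_measurable (lebesgue_on \<Omega>)" "G \<in> borel_measurable (lebesgue_on \<Omega>)"
    "v k \<in> borel_measurable (lebesgue_on \<Omega>)" "g k \<in> borel_measurable (lebesgue_on \<Omega>)"
proof -
  have v: "c1_compact \<Omega> (v k) (g k)"
    using assms by (simp add: limit_of_tests_def)
  show "c1_compact \<Omega> (v k) (g k)" "u \<in> borel_measurable (lebesgue_on \<Omega>)" "G \<in> borel_measurable (lebesgue_on \<Omega>)"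
    "v k \<in> borel_measurable (lebesgue_on \<Omega>)" "g k \<in> borel_measurable (lebesgue_on \<Omega>)"
    using assms v c1_compact_measurable[OF v]
    by (auto simp: limit_of_tests_def intro: borel_measurable_lebesgue_on)
qed

lemma radial_energy_diff_tendsto_0:
  assumes "limit_of_tests v g u G"
  shows "(\<lambda>k. radial_energy (\<lambda>x. g k x - G x)) \<longlonglongrightarrow> 0"
  using assms by (intro ennreal_tendsto_0_le[OF _ radial_energy_le]) (simp add: limit_of_tests_def)

lemma radial_energy_tendsto:
  assumes L: "limit_of_tests v g u G"
  shows "(\<lambda>k. radial_energy (g k)) \<longlonglongrightarrow> radial_energy G"
proof -
  note [measurable] = limit_of_testsD[OF L]
  have "(\<lambda>k. \<integral>\<^sup>+x. ennreal (radial_weight x * \<bar>(x \<bullet> g k x) / norm x - (x \<bullet> G x) / norm x\<bar> powr p) \<partial>lebesgue_on \<Omega>) \<longlonglongrightarrow> 0"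
    using radial_energy_diff_tendsto_0[OF L]
    by (simp add: radial_energy_def inner_diff_right diff_divide_distrib)
  then show ?thesis
    unfolding radial_energy_def using p
    by (intro tendsto_nn_integral_weighted_powr weight_nonneg) (auto simp: borel_measurable_lebesgue_on)
qed

lemma radial_energy_limit_finite:
  assumes L: "limit_of_tests v g u G"
  shows "radial_energy G < \<infinity>"
proof -
  note [measurable] = limit_of_testsD[OF L]
  have "eventually (\<lambda>k. radial_energy (\<lambda>x. g k x - G x) < \<infinity>) sequentially"
    by (rule order_tendstoD(2)[OF radial_energy_diff_tendsto_0[OF L]]) simp
  then obtain k where k: "radial_energy (\<lambda>x. g k x - G x) < \<infinity>"
    by (auto simp: eventually_sequentially)
  have "radial_energy G = radial_energy (\<lambda>x. g k x - (g k x - G x))" by simp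
  also have "\<dots> \<le> ennreal ((1 / 2) powr (1 - p)) * radial_energy (g k) + ennreal ((1 / 2) powr (1 - p)) * radial_energy (\<lambda>x. g k x - G x)"
    by (rule radial_energy_diff_le) measurable
  also have "\<dots> < \<infinity>"
    using k le_less_trans[OF radial_energy_le gradient_energy_finite[OF limit_of_testsD(1)[OF L]]]
    by (simp add: ennreal_mult_less_top)
  finally show ?thesis .
qed

text \<open>The Hardy inequality makes \<open>v\<close> Cauchy in the weighted space on an annulus; Fatou along a
  subsequence converging almost everywhere identifies the limit as \<open>u\<close>.\<close>

lemma hardy_annulus_diff_le:
  assumes L: "limit_of_tests v g u G" and \<epsilon>: "0 < \<epsilon>" "\<epsilon> < \<delta>"
  shows "hardy_annulus \<epsilon> (\<lambda>x. v k x - u x)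
    \<le> ennreal hardy_constant * (ennreal ((1 / 2) powr (1 - p)) * radial_energy (\<lambda>x. g k x - G x))"
proof -
  note [measurable] = limit_of_testsD[OF L]
  let ?c = "ennreal ((1 / 2) powr (1 - p))"
  let ?C = "ennreal hardy_constant"
  have "(\<lambda>k. \<integral>\<^sup>+x. ennreal \<bar>v k x - u x\<bar> \<partial>lebesgue_on \<Omega>) \<longlonglongrightarrow> 0"
    using L by (simp add: limit_of_tests_def)
  from AE_subseq_if_nn_integral_tendsto_0[OF _ this]
  obtain r :: "nat \<Rightarrow> nat" where r: "filterlim r at_top sequentially"
    "AE x in lebesgue_on \<Omega>. (\<lambda>i. v (r i) x - u x) \<longlonglongrightarrow> 0"
    by (auto simp: borel_measurable_diff limit_of_testsD[OF L])
  define f where "f i x = ennreal (annulus_weight \<epsilon> x * \<bar>v k x - v (r i) x\<bar> powr p)" for i x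
  have [measurable]: "f i \<in> borel_measurable (lebesgue_on \<Omega>)" for i
    unfolding f_def[abs_def] by (measurable; simp add: borel_measurable_lebesgue_on)
  have "hardy_annulus \<epsilon> (\<lambda>x. v k x - u x) = (\<integral>\<^sup>+x. liminf (\<lambda>i. f i x) \<partial>lebesgue_on \<Omega>)"
    unfolding hardy_annulus_def
  proof (rule nn_integral_cong_AE)
    show "AE x in lebesgue_on \<Omega>. ennreal (annulus_weight \<epsilon> x * \<bar>v k x - u x\<bar> powr p) = liminf (\<lambda>i. f i x)"
      using r(2)
    proof eventually_elim
      fix x assume "(\<lambda>i. v (r i) x - u x) \<longlonglongrightarrow> 0"
      then have "(\<lambda>i. (v k x - u x) - (v (r i) x - u x)) \<longlonglongrightarrow> (v k x - u x) - 0"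
        by (intro tendsto_diff tendsto_const)
      then have "(\<lambda>i. \<bar>v k x - v (r i) x\<bar> powr p) \<longlonglongrightarrow> \<bar>v k x - u x\<bar> powr p"
        using p by (intro tendsto_powr' tendsto_rabs tendsto_const) auto
      then have "(\<lambda>i. f i x) \<longlonglongrightarrow> ennreal (annulus_weight \<epsilon> x * \<bar>v k x - u x\<bar> powr p)"
        unfolding f_def by (intro tendsto_ennrealI tendsto_mult tendsto_const)
      then show "ennreal (annulus_weight \<epsilon> x * \<bar>v k x - u x\<bar> powr p) = liminf (\<lambda>i. f i x)"
        by (rule lim_imp_Liminf[symmetric, rotated]) simp
    qed
  qed
  also have "\<dots> \<le> liminf (\<lambda>i. \<integral>\<^sup>+x. f i x \<partial>lebesgue_on \<Omega>)"
    by (rule nn_integral_liminf) measurable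
  also have "\<dots> \<le> liminf (\<lambda>i. ?C * (?c * radial_energy (\<lambda>x. g k x - G x) + ?c * radial_energy (\<lambda>x. g (r i) x - G x)))"
  proof (intro Liminf_mono always_eventually allI)
    fix i
    have "(\<integral>\<^sup>+x. f i x \<partial>lebesgue_on \<Omega>) \<le> ?C * radial_energy (\<lambda>x. g k x - g (r i) x)"
      unfolding f_def hardy_annulus_def[symmetric]
      by (intro hardy_annulus_le \<epsilon> c1_compact_diff limit_of_testsD[OF L])
    also have "radial_energy (\<lambda>x. g k x - g (r i) x) = radial_energy (\<lambda>x. (g k x - G x) - (g (r i) x - G x))"
      by simp
    also have "\<dots> \<le> ?c * radial_energy (\<lambda>x. g k x - G x) + ?c * radial_energy (\<lambda>x. g (r i) x - G x)"
      by (rule radial_energy_diff_le) measurable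
    finally show "(\<integral>\<^sup>+x. f i x \<partial>lebesgue_on \<Omega>) \<le> ?C * (?c * radial_energy (\<lambda>x. g k x - G x) + ?c * radial_energy (\<lambda>x. g (r i) x - G x))"
      by (simp add: mult_left_mono)
  qed
  also have "\<dots> = ?C * (?c * radial_energy (\<lambda>x. g k x - G x) + ?c * 0)"
    using filterlim_compose[OF radial_energy_diff_tendsto_0[OF L] r(1)]
    by (intro lim_imp_Liminf ennreal_tendsto_cmult tendsto_add tendsto_const) auto
  finally show ?thesis by simp
qed

lemma hardy_annulus_tendsto:
  assumes L: "limit_of_tests v g u G" and \<epsilon>: "0 < \<epsilon>" "\<epsilon> < \<delta>"
  shows "(\<lambda>k. hardy_annulus \<epsilon> (v k)) \<longlonglongrightarrow> hardy_annulus \<epsilon> u"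
proof -
  note [measurable] = limit_of_testsD[OF L]
  have "(\<lambda>k. ennreal hardy_constant * (ennreal ((1 / 2) powr (1 - p)) * radial_energy (\<lambda>x. g k x - G x)))
      \<longlonglongrightarrow> ennreal hardy_constant * (ennreal ((1 / 2) powr (1 - p)) * 0)"
    by (intro ennreal_tendsto_cmult radial_energy_diff_tendsto_0[OF L]) auto
  then have "(\<lambda>k. hardy_annulus \<epsilon> (\<lambda>x. v k x - u x)) \<longlonglongrightarrow> 0"
    by (intro ennreal_tendsto_0_le[OF _ hardy_annulus_diff_le[OF L \<epsilon>]]) simp
  then show ?thesis
    unfolding hardy_annulus_def using p
    by (intro tendsto_nn_integral_weighted_powr weight_nonneg) (auto simp: borel_measurable_lebesgue_on)
qed

lemma hardy_annulus_limit_le: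
  assumes L: "limit_of_tests v g u G" and \<epsilon>: "0 < \<epsilon>" "\<epsilon> < \<delta>"
  shows "hardy_annulus \<epsilon> u \<le> ennreal hardy_constant * radial_energy G"
proof (rule LIMSEQ_le)
  show "(\<lambda>k. hardy_annulus \<epsilon> (v k)) \<longlonglongrightarrow> hardy_annulus \<epsilon> u"
    by (rule hardy_annulus_tendsto[OF L \<epsilon>])
  show "(\<lambda>k. ennreal hardy_constant * radial_energy (g k)) \<longlonglongrightarrow> ennreal hardy_constant * radial_energy G"
    by (intro ennreal_tendsto_cmult radial_energy_tendsto[OF L]) simp
  show "\<exists>N. \<forall>k\<ge>N. hardy_annulus \<epsilon> (v k) \<le> ennreal hardy_constant * radial_energy (g k)"
    using hardy_annulus_le[OF limit_of_testsD(1)[OF L] \<epsilon>] by blast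
qed

lemma sphere_term_tendsto:
  assumes v: "\<And>k. v k \<in> borel_measurable borel" and T: "T \<in> borel_measurable borel"
    and lim: "(\<lambda>k. \<integral>\<^sup>+x. ennreal (\<bar>v k x - T x\<bar> powr p) \<partial>sphere_measure \<epsilon>) \<longlonglongrightarrow> 0"
  shows "(\<lambda>k. sphere_term \<epsilon> (v k)) \<longlonglongrightarrow> sphere_term \<epsilon> T"
proof -
  note [measurable] = v T
  define w where "w x = 1 / \<phi> x powr (a * (p - 1))" for x
  have [measurable]: "w \<in> borel_measurable borel" unfolding w_def[abs_def] by measurable
  have [measurable]: "w \<in> borel_measurable (sphere_measure \<epsilon>)" by measurable
  define C where "C = 1 / min \<delta> (\<phi> 0) powr (a * (p - 1))"
  have pos: "0 < min \<delta> (\<phi> 0)" using \<delta> \<phi>_pos by simp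
  have w: "0 \<le> w x" "w x \<le> C" for x
  proof -
    have "min \<delta> (\<phi> 0) \<le> \<phi> x" using \<delta>_le_\<phi>[of x] by (cases "x = 0") auto
    then have "min \<delta> (\<phi> 0) powr (a * (p - 1)) \<le> \<phi> x powr (a * (p - 1))"
      using pos a p by (intro powr_mono2) auto
    then show "w x \<le> C"
      unfolding w_def C_def using pos by (intro frac_le) auto
  qed (simp add: w_def)
  have "(\<lambda>k. ennreal C * (\<integral>\<^sup>+x. ennreal (\<bar>v k x - T x\<bar> powr p) \<partial>sphere_measure \<epsilon>)) \<longlonglongrightarrow> ennreal C * 0"
    by (intro ennreal_tendsto_cmult lim) simp
  then have lim0: "(\<lambda>k. ennreal C * (\<integral>\<^sup>+x. ennreal (\<bar>v k x - T x\<bar> powr p) \<partial>sphere_measure \<epsilon>)) \<longlonglongrightarrow> 0"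
    by simp
  have "(\<lambda>k. \<integral>\<^sup>+x. ennreal (w x * \<bar>v k x - T x\<bar> powr p) \<partial>sphere_measure \<epsilon>) \<longlonglongrightarrow> 0"
  proof (rule ennreal_tendsto_0_le[OF lim0])
    fix k
    have "ennreal (w x * \<bar>v k x - T x\<bar> powr p) \<le> ennreal C * ennreal (\<bar>v k x - T x\<bar> powr p)" for x
      unfolding ennreal_mult''[OF powr_ge_zero, symmetric] by (intro ennreal_leI mult_right_mono w) simp
    then have "(\<integral>\<^sup>+x. ennreal (w x * \<bar>v k x - T x\<bar> powr p) \<partial>sphere_measure \<epsilon>)
       \<le> (\<integral>\<^sup>+x. ennreal C * ennreal (\<bar>v k x - T x\<bar> powr p) \<partial>sphere_measure \<epsilon>)"
      by (rule nn_integral_mono)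
    also have "\<dots> = ennreal C * (\<integral>\<^sup>+x. ennreal (\<bar>v k x - T x\<bar> powr p) \<partial>sphere_measure \<epsilon>)"
      by (rule nn_integral_cmult) measurable
    finally show "(\<integral>\<^sup>+x. ennreal (w x * \<bar>v k x - T x\<bar> powr p) \<partial>sphere_measure \<epsilon>) \<le> \<dots>" .
  qed
  then have "(\<lambda>k. \<integral>\<^sup>+x. ennreal (w x * \<bar>v k x\<bar> powr p) \<partial>sphere_measure \<epsilon>) \<longlonglongrightarrow> (\<integral>\<^sup>+x. ennreal (w x * \<bar>T x\<bar> powr p) \<partial>sphere_measure \<epsilon>)"
    using w p by (intro tendsto_nn_integral_weighted_powr) auto
  then show ?thesis
    unfolding sphere_term_def by (intro ennreal_tendsto_cmult) (auto simp: w_def)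
qed

lemma hardy_young_limit:
  assumes L: "limit_of_tests v g u G" and \<epsilon>: "0 < \<epsilon>" "\<epsilon> < \<delta>" and \<mu>: "0 < \<mu>"
    and T: "T \<in> borel_measurable borel"
    and lim: "(\<lambda>k. \<integral>\<^sup>+x. ennreal (\<bar>v k x - T x\<bar> powr p) \<partial>sphere_measure \<epsilon>) \<longlonglongrightarrow> 0"
  shows "ennreal (a * (p - 1)) * hardy_annulus \<epsilon> u + sphere_term \<epsilon> T
    \<le> ennreal (\<mu> powr (1 - p)) * radial_energy G + ennreal ((p - 1) * \<mu>) * hardy_annulus \<epsilon> u"
proof (rule LIMSEQ_le)
  show "(\<lambda>k. ennreal (a * (p - 1)) * hardy_annulus \<epsilon> (v k) + sphere_term \<epsilon> (v k))
    \<longlonglongrightarrow> ennreal (a * (p - 1)) * hardy_annulus \<epsilon> u + sphere_term \<epsilon> T"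
    using c1_compact_measurable[OF limit_of_testsD(1)[OF L]]
    by (intro tendsto_add ennreal_tendsto_cmult hardy_annulus_tendsto[OF L \<epsilon>] sphere_term_tendsto T lim) auto
  show "(\<lambda>k. ennreal (\<mu> powr (1 - p)) * radial_energy (g k) + ennreal ((p - 1) * \<mu>) * hardy_annulus \<epsilon> (v k))
    \<longlonglongrightarrow> ennreal (\<mu> powr (1 - p)) * radial_energy G + ennreal ((p - 1) * \<mu>) * hardy_annulus \<epsilon> u"
    by (intro tendsto_add ennreal_tendsto_cmult hardy_annulus_tendsto[OF L \<epsilon>] radial_energy_tendsto[OF L]) auto
qed (use hardy_young_test[OF limit_of_testsD(1)[OF L] \<epsilon> \<mu>] in blast)

lemma hardy_annulus_antimono: "\<epsilon> \<le> \<epsilon>' \<Longrightarrow> hardy_annulus \<epsilon>' u \<le> hardy_annulus \<epsilon> u"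
  unfolding hardy_annulus_def
  by (intro nn_integral_mono ennreal_leI mult_right_mono)
     (auto simp: annulus_weight_def hardy_weight_def)

lemma hardy_annulus_le_energy: "hardy_annulus \<epsilon> u \<le> hardy_energy u"
  unfolding hardy_annulus_def hardy_energy_def
  by (intro nn_integral_mono ennreal_leI mult_right_mono)
     (auto simp: annulus_weight_def hardy_weight_def)

lemma hardy_annulus_tendsto_energy:
  assumes [measurable]: "u \<in> borel_measurable (lebesgue_on \<Omega>)"
  shows "(\<lambda>k. hardy_annulus (1 / real (Suc k)) u) \<longlonglongrightarrow> hardy_energy u"
  unfolding hardy_annulus_def hardy_energy_def
proof (rule nn_integral_LIMSEQ)
  show "incseq (\<lambda>k x. ennreal (annulus_weight (1 / real (Suc k)) x * \<bar>u x\<bar> powr p))"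
  proof (intro incseq_SucI le_funI ennreal_leI mult_right_mono)
    fix k x
    have "1 / real (Suc (Suc k)) \<le> 1 / real (Suc k)"
      by (simp add: frac_le)
    then show "annulus_weight (1 / real (Suc k)) x \<le> annulus_weight (1 / real (Suc (Suc k))) x"
      using weight_nonneg(1)[of x] by (auto simp: annulus_weight_def)
  qed simp
  show "(\<lambda>k. ennreal (annulus_weight (1 / real (Suc k)) x * \<bar>u x\<bar> powr p)) \<longlonglongrightarrow> ennreal (hardy_weight x * \<bar>u x\<bar> powr p)" for x
  proof (cases "x = 0")
    case True
    then show ?thesis by (simp add: annulus_weight_def hardy_weight_def)
  next
    case False
    have "eventually (\<lambda>k. 1 / real (Suc k) < norm x) sequentially"
      by (rule order_tendstoD(2)[OF LIMSEQ_Suc[OF lim_1_over_n]]) (use False in simp)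
    then have "eventually (\<lambda>k. ennreal (annulus_weight (1 / real (Suc k)) x * \<bar>u x\<bar> powr p)
        = ennreal (hardy_weight x * \<bar>u x\<bar> powr p)) sequentially"
      by eventually_elim (simp add: annulus_weight_def)
    then show ?thesis by (rule tendsto_eventually)
  qed
qed (simp add: borel_measurable_lebesgue_on)

lemma hardy_energy_le:
  assumes L: "limit_of_tests v g u G"
  shows "hardy_energy u \<le> ennreal hardy_constant * radial_energy G"
proof (rule LIMSEQ_le_const2[OF hardy_annulus_tendsto_energy[OF limit_of_testsD(2)[OF L]]])
  have "eventually (\<lambda>k. 1 / real (Suc k) < \<delta>) sequentially"
    by (rule order_tendstoD(2)[OF LIMSEQ_Suc[OF lim_1_over_n]]) (use \<delta> in simp)
  then have "eventually (\<lambda>k. hardy_annulus (1 / real (Suc k)) u \<le> ennreal hardy_constant * radial_energy G) sequentially"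
    by eventually_elim (intro hardy_annulus_limit_le[OF L], simp_all)
  then show "\<exists>N. \<forall>k\<ge>N. hardy_annulus (1 / real (Suc k)) u \<le> ennreal hardy_constant * radial_energy G"
    by (simp add: eventually_sequentially)
qed

lemma hardy_sphere_term_le:
  assumes L: "limit_of_tests v g u G" and \<epsilon>: "0 < \<epsilon>" "\<epsilon> < \<delta>"
    and T: "T \<in> borel_measurable borel"
    and lim: "(\<lambda>k. \<integral>\<^sup>+x. ennreal (\<bar>v k x - T x\<bar> powr p) \<partial>sphere_measure \<epsilon>) \<longlonglongrightarrow> 0"
    and A: "radial_energy G = ennreal A" "0 < A" and K: "hardy_energy u = ennreal K" "0 < K"
  shows "ennreal (a * (p - 1)) * hardy_annulus \<epsilon> u + sphere_term \<epsilon> T \<le> ennreal (p * A powr (1 / p) * K powr (1 - 1 / p))"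
proof -
  \<comment> \<open>the minimiser of \<open>\<mu> powr (1 - p) * A + (p - 1) * \<mu> * K\<close>\<close>
  define \<mu> where "\<mu> = (A / K) powr (1 / p)"
  have \<mu>: "0 < \<mu>" using A K by (simp add: \<mu>_def)
  have "\<mu> powr (1 - p) * A = A powr (1 / p) * K powr (1 - 1 / p)"
  proof -
    have "\<mu> powr (1 - p) = A powr ((1 - p) / p) / K powr ((1 - p) / p)"
      using A K by (simp add: \<mu>_def powr_powr powr_divide)
    moreover have "A powr (1 / p) = A powr ((1 - p) / p) * A"
      using A p powr_add[of A "(1 - p) / p" 1] by (simp add: add_divide_distrib[symmetric] diff_divide_distrib)
    moreover have "K powr (1 - 1 / p) = 1 / K powr ((1 - p) / p)"
      using p powr_minus_divide[of K "(1 - p) / p"] by (simp add: diff_divide_distrib)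
    ultimately show ?thesis by simp
  qed
  moreover have "\<mu> * K = A powr (1 / p) * K powr (1 - 1 / p)"
    using A K by (simp add: \<mu>_def powr_divide powr_diff)
  ultimately have opt: "\<mu> powr (1 - p) * A + (p - 1) * \<mu> * K = p * A powr (1 / p) * K powr (1 - 1 / p)"
    by (simp add: algebra_simps)
  have "ennreal (a * (p - 1)) * hardy_annulus \<epsilon> u + sphere_term \<epsilon> T
    \<le> ennreal (\<mu> powr (1 - p)) * ennreal A + ennreal ((p - 1) * \<mu>) * hardy_annulus \<epsilon> u"
    using hardy_young_limit[OF L \<epsilon> \<mu> T lim] A by simp
  also have "\<dots> \<le> ennreal (\<mu> powr (1 - p)) * ennreal A + ennreal ((p - 1) * \<mu>) * ennreal K"
    using hardy_annulus_le_energy[of \<epsilon> u] K by (intro add_mono mult_left_mono) auto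
  also have "\<dots> = ennreal (\<mu> powr (1 - p) * A + (p - 1) * \<mu> * K)"
    using A K \<mu> p by (subst ennreal_plus) (auto simp: ennreal_mult)
  finally show ?thesis by (simp add: opt)
qed

lemma hardy_Limsup_le:
  assumes u: "u \<in> borel_measurable (lebesgue_on \<Omega>)"
    and T: "\<And>\<epsilon>. 0 < \<epsilon> \<Longrightarrow> \<epsilon> < \<delta> \<Longrightarrow> T \<epsilon> \<in> borel_measurable borel \<and> (\<exists>v g. limit_of_tests v g u G \<and>
      (\<lambda>k. \<integral>\<^sup>+x. ennreal (\<bar>v k x - T \<epsilon> x\<bar> powr p) \<partial>sphere_measure \<epsilon>) \<longlonglongrightarrow> 0)"
    and A: "radial_energy G = ennreal A" "0 < A" and K: "hardy_energy u = ennreal K" "0 < K"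
  shows "ennreal (a * (p - 1)) * ennreal K + Limsup (at_right 0) (\<lambda>\<epsilon>. sphere_term \<epsilon> (T \<epsilon>))
    \<le> ennreal (p * A powr (1 / p) * K powr (1 - 1 / p))" (is "_ + ?L \<le> ?X")
proof -
  have step: "ennreal (a * (p - 1)) * hardy_annulus \<epsilon>0 u + ?L \<le> ?X" if \<epsilon>0: "0 < \<epsilon>0" for \<epsilon>0
  proof -
    let ?K0 = "ennreal (a * (p - 1)) * hardy_annulus \<epsilon>0 u"
    have "hardy_annulus \<epsilon>0 u < top"
      using le_less_trans[OF hardy_annulus_le_energy[of \<epsilon>0 u]] K by simp
    then have fin: "?K0 < top" by (simp add: ennreal_mult_less_top)
    have le: "?K0 + sphere_term \<epsilon> (T \<epsilon>) \<le> ?X" if \<epsilon>: "0 < \<epsilon>" "\<epsilon> < \<delta>" "\<epsilon> \<le> \<epsilon>0" for \<epsilon>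
    proof -
      obtain v g where "T \<epsilon> \<in> borel_measurable borel" "limit_of_tests v g u G"
        "(\<lambda>k. \<integral>\<^sup>+x. ennreal (\<bar>v k x - T \<epsilon> x\<bar> powr p) \<partial>sphere_measure \<epsilon>) \<longlonglongrightarrow> 0"
        using T[OF \<epsilon>(1,2)] by blast
      then have "ennreal (a * (p - 1)) * hardy_annulus \<epsilon> u + sphere_term \<epsilon> (T \<epsilon>) \<le> ?X"
        by (intro hardy_sphere_term_le[OF _ \<epsilon>(1,2) _ _ A K])
      then show ?thesis
        using hardy_annulus_antimono[OF \<epsilon>(3), of u] by (meson add_right_mono mult_left_mono order_trans zero_le)
    qed
    have "eventually (\<lambda>\<epsilon>. sphere_term \<epsilon> (T \<epsilon>) \<le> ?X - ?K0) (at_right 0)"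
      unfolding eventually_at_right_field
    proof (intro exI[of _ "min \<delta> \<epsilon>0"] conjI allI impI)
      fix \<epsilon> :: real assume "0 < \<epsilon>" "\<epsilon> < min \<delta> \<epsilon>0"
      then have "?K0 + sphere_term \<epsilon> (T \<epsilon>) \<le> ?X" by (intro le) auto
      then have "(?K0 + sphere_term \<epsilon> (T \<epsilon>)) - ?K0 \<le> ?X - ?K0" by (rule ennreal_minus_mono) simp
      then show "sphere_term \<epsilon> (T \<epsilon>) \<le> ?X - ?K0" using fin by simp
    qed (use \<delta> \<epsilon>0 in simp)
    then have "?L \<le> ?X - ?K0" by (rule Limsup_bounded)
    moreover have "?K0 \<le> ?X"
      using \<delta> \<epsilon>0 by (intro order_trans[OF _ le[of "min (\<delta> / 2) \<epsilon>0"]]) simp_all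
    ultimately show ?thesis
      by (metis add_left_mono add_diff_inverse_ennreal)
  qed
  have "(\<lambda>k. ennreal (a * (p - 1)) * hardy_annulus (1 / real (Suc k)) u + ?L) \<longlonglongrightarrow> ennreal (a * (p - 1)) * ennreal K + ?L"
    unfolding K(1)[symmetric]
    by (intro tendsto_add ennreal_tendsto_cmult hardy_annulus_tendsto_energy u tendsto_const) simp
  then show ?thesis
    by (rule LIMSEQ_le_const2) (use step in auto)
qed

end

theorem theorem5p1:
  fixes \<Omega> :: "(real ^ 'n) set" and \<phi> :: "real ^ 'n \<Rightarrow> real"
    and n p p' m l \<delta> :: real
    and u :: "real ^ 'n \<Rightarrow> real" and G :: "real ^ 'n \<Rightarrow> real ^ 'n"
    and T :: "real \<Rightarrow> real ^ 'n \<Rightarrow> real"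
  assumes "n = real CARD('n)" and "2 \<le> n"
    and "1 < p" and "1 / p + 1 / p' = 1"
    and "m = (p - n) / (p - 1)"
    and "- m < l" and "l \<le> 1 - m"
    and "\<And>x. 0 < \<phi> x" and "homogeneous0 \<phi>"
    and "\<Omega> = {x. norm x < \<phi> x}"
    and "domain \<Omega>" and "bounded \<Omega>"
    and "0 < \<delta>" and "star_shaped_ball \<Omega> (ball 0 \<delta>)"
    and "W0_with_gradient p l \<Omega> u G"
    and "\<not> (AE x in lebesgue_on \<Omega>. u x = 0)"
    and "\<And>\<epsilon>. 0 < \<epsilon> \<Longrightarrow> sphere 0 \<epsilon> \<subseteq> \<Omega> \<Longrightarrow> trace_on_sphere p l \<Omega> u G \<epsilon> (T \<epsilon>)"
  defines "A \<equiv> \<lambda>x. norm x powr (l * (1 - p)) * \<bar>(x \<bullet> G x) / norm x\<bar> powr p"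
    and "K \<equiv> \<lambda>x. \<bar>u x\<bar> powr p /
              (norm x powr (n - m - l) * \<bar>\<phi> x powr (m + l) - norm x powr (m + l)\<bar> powr p)"
  shows "integrable (lebesgue_on \<Omega>) A \<and> integrable (lebesgue_on \<Omega>) K \<and>
    ennreal ((LINT x|lebesgue_on \<Omega>. A x) powr (1 / p)) \<ge>
      ennreal ((m + l) / p' * (LINT x|lebesgue_on \<Omega>. K x) powr (1 / p)) +
      ennreal (1 / p) *
        Limsup (at_right 0) (\<lambda>\<epsilon>. ennreal (\<epsilon> powr (1 - n)) *
          (\<integral>\<^sup>+x. ennreal (\<bar>T \<epsilon> x\<bar> powr p / \<phi> x powr ((m + l) * (p - 1))) \<partial>sphere_measure \<epsilon>)) *
        ennreal ((LINT x|lebesgue_on \<Omega>. K x) powr (- 1 / p'))"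
proof -
  define a where "a = m + l"
  interpret radial_hardy \<Omega> \<phi> n a p \<delta>
    using assms(1-14)
    by unfold_locales (auto simp: a_def homogeneous0_def domain_def star_shaped_ball_def)
  have exponent: "l * (1 - p) = (1 - a) * (p - 1) + 1 - n"
    using \<open>1 < p\<close> \<open>m = _\<close> by (simp add: a_def field_simps)
  have inv_p': "1 / p' = 1 - 1 / p"
    using \<open>1 / p + 1 / p' = 1\<close> by simp
  have A_eq: "A x = radial_weight x * \<bar>(x \<bullet> G x) / norm x\<bar> powr p" for x
    by (simp add: A_def radial_weight_def exponent)
  have K_eq: "K x = hardy_weight x * \<bar>u x\<bar> powr p" for x
  proof -
    have "n - m - l = n - a" by (simp add: a_def)
    then show ?thesis unfolding K_def hardy_weight_def a_def[symmetric] by (simp only:) simp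
  qed
  have u [measurable]: "u \<in> borel_measurable (lebesgue_on \<Omega>)" and G [measurable]: "G \<in> borel_measurable (lebesgue_on \<Omega>)"
    using assms(15) by (auto simp: W0_with_gradient_def)
  have limits: "limit_of_tests v (\<lambda>k. gradient (v k)) u G" if "approximates p l \<Omega> v u G" for v
    using that u G test_function_c1_compact
    by (auto simp: approximates_def weighted_energy_def limit_of_tests_def radial_weight_def exponent)
  obtain v where "approximates p l \<Omega> v u G"
    using assms(15) by (auto simp: W0_with_gradient_def)
  note L = limits[OF this]
  define IA where "IA = (LINT x|lebesgue_on \<Omega>. A x)"
  define IK where "IK = (LINT x|lebesgue_on \<Omega>. K x)"
  have hw [measurable]: "hardy_weight \<in> borel_measurable (lebesgue_on \<Omega>)"
    and rw [measurable]: "radial_weight \<in> borel_measurable (lebesgue_on \<Omega>)"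
    by (simp_all add: borel_measurable_lebesgue_on)
  have A_meas: "A \<in> borel_measurable (lebesgue_on \<Omega>)" and K_meas: "K \<in> borel_measurable (lebesgue_on \<Omega>)"
    unfolding A_eq[abs_def] K_eq[abs_def] by measurable
  have A_nonneg: "0 \<le> A x" and K_nonneg: "0 \<le> K x" for x
    by (simp_all add: A_eq K_eq weight_nonneg)
  have A_fin: "radial_energy G < \<infinity>" by (rule radial_energy_limit_finite[OF L])
  have K_fin: "hardy_energy u < \<infinity>"
    using le_less_trans[OF hardy_energy_le[OF L]] A_fin by (simp add: ennreal_mult_less_top)
  have A_int: "integrable (lebesgue_on \<Omega>) A"
    using A_fin A_meas A_nonneg by (intro integrableI_nonneg) (auto simp: radial_energy_def A_eq)
  have K_int: "integrable (lebesgue_on \<Omega>) K"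
    using K_fin K_meas K_nonneg by (intro integrableI_nonneg) (auto simp: hardy_energy_def K_eq)
  have IA: "radial_energy G = ennreal IA"
    unfolding radial_energy_def IA_def A_eq[symmetric]
    by (rule nn_integral_eq_integral[OF A_int]) (simp add: A_nonneg)
  have IK: "hardy_energy u = ennreal IK"
    unfolding hardy_energy_def IK_def K_eq[symmetric]
    by (rule nn_integral_eq_integral[OF K_int]) (simp add: K_nonneg)
  have "IK \<noteq> 0"
  proof
    assume "IK = 0"
    then have ae: "AE x in lebesgue_on \<Omega>. K x = 0"
      using integral_nonneg_eq_0_iff_AE[OF K_int] K_nonneg by (simp add: IK_def)
    have ae0: "AE x in lebesgue_on \<Omega>. x \<noteq> 0"
      using AE_lborel_singleton[of "0 :: real ^ 'n"] \<Omega>_open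
      by (subst AE_restrict_space_iff) (auto intro!: AE_completion elim: AE_mp)
    have ae\<Omega>: "AE x in lebesgue_on \<Omega>. x \<in> \<Omega>"
      by (rule AE_I2) simp
    have "AE x in lebesgue_on \<Omega>. u x = 0"
      using ae ae0 ae\<Omega>
    proof eventually_elim
      fix x assume x: "K x = 0" "x \<noteq> 0" "x \<in> \<Omega>"
      then have "norm x powr a < \<phi> x powr a"
        using a by (intro powr_less_mono2) (auto simp: \<Omega>_eq)
      then have "hardy_weight x \<noteq> 0"
        using x by (simp add: hardy_weight_def)
      then show "u x = 0" using x(1) by (simp add: K_eq)
    qed
    then show False using assms(16) by blast
  qed
  then have IK_pos: "0 < IK"
    using K_nonneg by (simp add: IK_def order_less_le)
  have IA_pos: "0 < IA"
  proof (rule ccontr)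
    assume "\<not> 0 < IA"
    then show False
      using hardy_energy_le[OF L] IK_pos by (simp add: IA IK ennreal_neg)
  qed
  let ?L = "Limsup (at_right 0) (\<lambda>\<epsilon>. sphere_term \<epsilon> (T \<epsilon>))"
  have main: "ennreal (a * (p - 1)) * ennreal IK + ?L \<le> ennreal (p * IA powr (1 / p) * IK powr (1 - 1 / p))"
  proof (rule hardy_Limsup_le[OF u _ IA IA_pos IK IK_pos])
    fix \<epsilon> :: real assume \<epsilon>: "0 < \<epsilon>" "\<epsilon> < \<delta>"
    then have "sphere 0 \<epsilon> \<subseteq> \<Omega>" using \<delta>(2) by auto
    then have "trace_on_sphere p l \<Omega> u G \<epsilon> (T \<epsilon>)" by (rule assms(17)[OF \<epsilon>(1)])
    then show "T \<epsilon> \<in> borel_measurable borel \<and> (\<exists>v g. limit_of_tests v g u G \<and>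
      (\<lambda>k. \<integral>\<^sup>+x. ennreal (\<bar>v k x - T \<epsilon> x\<bar> powr p) \<partial>sphere_measure \<epsilon>) \<longlonglongrightarrow> 0)"
      unfolding trace_on_sphere_def using limits by blast
  qed
  define c where "c = 1 / p * IK powr (- 1 / p')"
  have c: "0 \<le> c" using \<open>1 < p\<close> by (simp add: c_def)
  have "- 1 / p' = 1 / p - 1"
    using inv_p' by simp
  then have c_eq: "c = 1 / p * IK powr (1 / p - 1)"
    by (simp only: c_def)
  have c1: "c * (p * IA powr (1 / p) * IK powr (1 - 1 / p)) = IA powr (1 / p)"
  proof -
    have "IK powr (1 / p - 1) * IK powr (1 - 1 / p) = 1"
      using IK_pos by (simp add: powr_add[symmetric])
    then show ?thesis using \<open>1 < p\<close> by (simp add: c_eq)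
  qed
  have c2: "c * (a * (p - 1) * IK) = a / p' * IK powr (1 / p)"
  proof -
    have "IK powr (1 / p - 1) * IK = IK powr (1 / p)"
      using IK_pos powr_add[of IK "1 / p - 1" 1] by simp
    moreover have "(p - 1) / p = 1 / p'"
      using \<open>1 < p\<close> unfolding inv_p' by (simp add: diff_divide_distrib)
    moreover have "c * (a * (p - 1) * IK) = a * ((p - 1) / p) * (IK powr (1 / p - 1) * IK)"
      by (simp add: c_eq)
    ultimately show ?thesis by (simp only: times_divide_eq_right mult_1_right)
  qed
  have "ennreal (a / p' * IK powr (1 / p)) + ennreal (1 / p) * ?L * ennreal (IK powr (- 1 / p'))
     = ennreal c * (ennreal (a * (p - 1)) * ennreal IK + ?L)"
  proof -
    have "ennreal c * (ennreal (a * (p - 1)) * ennreal IK) = ennreal (a / p' * IK powr (1 / p))"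
      using c a p IK_pos by (simp add: ennreal_mult[symmetric] c2)
    moreover have "ennreal (1 / p) * ?L * ennreal (IK powr (- 1 / p')) = ennreal c * ?L"
    proof -
      have "ennreal c = ennreal (1 / p) * ennreal (IK powr (- 1 / p'))"
        unfolding c_def using p by (intro ennreal_mult) auto
      then show ?thesis by (simp only: ac_simps)
    qed
    ultimately show ?thesis by (simp only: distrib_left)
  qed
  also have "\<dots> \<le> ennreal c * ennreal (p * IA powr (1 / p) * IK powr (1 - 1 / p))"
    by (intro mult_left_mono main) simp
  also have "\<dots> = ennreal (IA powr (1 / p))"
    using c p by (simp add: ennreal_mult[symmetric] c1)
  finally show ?thesis
    using A_int K_int unfolding sphere_term_def IA_def[symmetric] IK_def[symmetric] a_def[symmetric] by blast
qed

end
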